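(* Let $d\ge 1$, let $a_1,b_1,\ldots,a_d,b_d$ be positive integers, and let $$\boldsymbol{k}=(\underbrace{1,\ldots,1}_{a_1-1},b_1+1,\ldots,\underbrace{1,\ldots,1}_{a_d-1},b_d+1).$$ For every $s\in\mathbb{C}$ with $\Re(s)>-1$, \begin{align*} I_{\boldsymbol{k}}(s) &=\frac{1}{(a_1-1)!(b_1-1)! \cdots (a_d-1)! (b_d-1)!\, \Gamma (s+1) } \int_{0<t_1<\cdots < t_{2d}<1} \frac{dt_1 \cdots dt_{2d}}{(1-t_1)t_2 \cdots (1-t_{2d-1})t_{2d} }\\ &\quad\times \prod_{\ell=1}^{d}\left( \log \frac{1-t_{2\ell-1}}{1-t_{2\ell}} \right)^{a_\ell-1} \left( \log \frac{t_{2\ell+1}}{t_{2\ell}} \right)^{b_\ell-1} \cdot\left( \log \frac{t_2 t_4\cdots t_{2d} }{t_1 t_3\cdots t_{2d-1}} \right)^{s}, \end{align*} where $t_{2d+1}:=1$.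
   Context: An index $\boldsymbol{k}=(k_1,\ldots,k_r)$ of positive integers is admissible if $k_r\ge2$; every admissible index can be written in the displayed form, with $r=a_1+\cdots+a_d$. For an admissible index $\boldsymbol{k}=(k_1,\ldots,k_r)$ and $s\in\mathbb{C}$ with $\Re(s)>-1$, the Ohno function is defined by the absolutely convergent series $$I_{\boldsymbol{k}}(s):=\sum_{i=1}^{r}\ \sum_{0<n_1<\cdots<n_r} \frac{1}{n_1^{k_1}\cdots n_r^{k_r}}\cdot \frac{1}{n_i^{s}} \prod_{\substack{1\le j\le r\\ j\ne i}} \frac{n_j}{ n_j-n_i }.$$ Complex powers of positive reals are $x^s=e^{s\log x}$ with the real logarithm; $0^0=x^0=1$ for exponents equal to $0$. *)

theory Defs
  imports "HOL-Analysis.Analysis"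
begin

text \<open>An index \<open>(k\<^sub>1, \<dots>, k\<^sub>r)\<close> is a list \<open>ks\<close> of positive integers; its entries
  are \<open>ks ! 0, \<dots>, ks ! (r - 1)\<close> with \<open>r = length ks\<close>.\<close>

definition increasing_tuples :: "nat \<Rightarrow> nat list set" where
  "increasing_tuples r = {ns. length ns = r \<and> sorted_wrt (<) ns \<and> (\<forall>n\<in>set ns. 0 < n)}"

definition Ohno_term :: "nat list \<Rightarrow> complex \<Rightarrow> nat \<Rightarrow> nat list \<Rightarrow> complex" where
  "Ohno_term ks s i ns =
     1 / (\<Prod>j<length ks. of_nat (ns ! j) ^ (ks ! j)) *
     (1 / of_nat (ns ! i) powr s) *
     (\<Prod>j\<in>{..<length ks} - {i}. of_nat (ns ! j) / (of_nat (ns ! j) - of_nat (ns ! i)))"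

text \<open>This agrees with the Ohno function when \<open>ks\<close> is admissible (nonempty, positive
  entries, last entry at least 2) and \<open>Re s > -1\<close>. Elsewhere \<^const>\<open>infsum\<close> may return its
  default value 0.\<close>

definition Ohno_function :: "nat list \<Rightarrow> complex \<Rightarrow> complex" where
  "Ohno_function ks s =
     (\<Sum>i<length ks. \<Sum>\<^sub>\<infinity>ns\<in>increasing_tuples (length ks). Ohno_term ks s i ns)"

definition block_index :: "nat \<Rightarrow> (nat \<Rightarrow> nat) \<Rightarrow> (nat \<Rightarrow> nat) \<Rightarrow> nat list" where
  "block_index d a b = concat (map (\<lambda>l. replicate (a l - 1) 1 @ [b l + 1]) [1..<d+1])"

text \<open>Points of \<open>\<real>\<^sup>m\<close> are the functions in \<open>space (lebesgue_power m)\<close>, with coordinates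
  \<open>t 1, \<dots>, t m\<close>; outside \<open>{1..m}\<close> they are \<open>undefined\<close>.\<close>

definition lebesgue_power :: "nat \<Rightarrow> (nat \<Rightarrow> real) measure" where
  "lebesgue_power m = Pi\<^sub>M {1..m} (\<lambda>_. lborel)"

definition open_simplex :: "nat \<Rightarrow> (nat \<Rightarrow> real) set" where
  "open_simplex m = {t \<in> space (lebesgue_power m).
     0 < t 1 \<and> (\<forall>j\<in>{1..<m}. t j < t (j + 1)) \<and> t m < 1}"

text \<open>The update to \<open>u\<close> implements the convention \<open>t\<^bsub>2d+1\<^esub> = 1\<close>. On the simplex the base of the
  complex power is a positive real, so \<^const>\<open>powr\<close> uses the real logarithm there.\<close>

definition Ohno_integrand ::
    "nat \<Rightarrow> (nat \<Rightarrow> nat) \<Rightarrow> (nat \<Rightarrow> nat) \<Rightarrow> complex \<Rightarrow> (nat \<Rightarrow> real) \<Rightarrow> complex" where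
  "Ohno_integrand d a b s t = (let u = t(2 * d + 1 := 1) in
     of_real (\<Prod>l=1..d. 1 / ((1 - u (2*l - 1)) * u (2*l))) *
     of_real (\<Prod>l=1..d. ln ((1 - u (2*l - 1)) / (1 - u (2*l))) ^ (a l - 1) *
                        ln (u (2*l + 1) / u (2*l)) ^ (b l - 1)) *
     of_real (ln ((\<Prod>l=1..d. u (2*l)) / (\<Prod>l=1..d. u (2*l - 1)))) powr s)"

end

theory Submission
  imports Defs "HOL-Probability.Probability"
begin

text \<open>
  Why the theorem holds. For distinct positive numbers \<open>n\<^sub>1, \<dots>, n\<^sub>r\<close> the coefficients
  \<open>c\<^sub>i = \<Prod>\<^bsub>j \<noteq> i\<^esub> n\<^sub>j / (n\<^sub>j - n\<^sub>i)\<close> of the Ohno series are those of the partial fraction expansion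
  \<open>\<Prod>\<^sub>j n\<^sub>j / (n\<^sub>j + z) = \<Sum>\<^sub>i c\<^sub>i n\<^sub>i / (n\<^sub>i + z)\<close>. Therefore \<open>f\<^sub>n(u) = \<Sum>\<^sub>i c\<^sub>i n\<^sub>i exp (-n\<^sub>i u)\<close> is the
  density of a sum of independent exponential variables with rates \<open>n\<^sub>1, \<dots>, n\<^sub>r\<close>: its Laplace
  transform is that product (\<open>partial_fractions\<close>, \<open>nn_integral_hypoexp_laplace\<close>) and it is
  nonnegative (\<open>hypoexp_density_nonneg\<close>). Its moments are
  \<open>\<integral> u\<^sup>s f\<^sub>n(u) du = \<Gamma>(s + 1) \<Sum>\<^sub>i c\<^sub>i n\<^sub>i\<^bsup>-s\<^esup>\<close>. Summing over all increasing tuples with the weights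
  \<open>\<Prod>\<^sub>j n\<^sub>j\<^bsup>-k\<^sub>j\<^esup>\<close>, the value \<open>\<Gamma>(s + 1) I\<^sub>k(s)\<close> is the moment of order \<open>s\<close> of a finite
  positive measure on the half line, a mixture of such laws (\<open>integral_mixture_powr\<close>).

  The integral over the simplex is also a moment of order \<open>s\<close>, namely of the law of
  \<open>L = log (t\<^sub>2 t\<^sub>4 \<cdots> / (t\<^sub>1 t\<^sub>3 \<cdots>))\<close> under the density formed by the remaining factors. So it
  suffices to show that the two laws agree up to the factorials (\<open>distr_log_ratio\<close>). A finite measure
  on the half line is determined by its Laplace transform at the natural numbers
  (\<open>measure_eqI_laplace\<close>), and there the simplex side can be computed: the factor \<open>exp (-N L)\<close>
  is a product of powers of the variables, hence the usual expansion of an iterated integral of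
  \<open>dt/(1-t)\<close> and \<open>dt/t\<close> into a nested sum applies, and it yields
  \<open>\<Sum> \<Prod>\<^sub>j n\<^sub>j\<^bsup>-k\<^sub>j\<^esup> n\<^sub>j / (n\<^sub>j + N)\<close> (\<open>nn_integral_simplex_density\<close>). All infinite sums and integrals in this
  computation have nonnegative terms, so they may be exchanged freely.

  What remains is convergence. The Ohno series converges absolutely (\<open>Ohno_term_abs_summable\<close>). At the
  real exponent \<open>Re s\<close> this bounds the absolute moment of the mixture, and by equality of the laws also
  the absolute value of the integrand on the simplex.
\<close>

section \<open>Partial fractions and sums of exponential variables\<close>

text \<open>Writing \<open>x / (x + z)\<close> for the Laplace transform of the exponential law of rate \<open>x\<close>, these are
  the coefficients that turn a product of such transforms into a linear combination.\<close>

definition lagrange_weight :: "'a::field set \<Rightarrow> 'a \<Rightarrow> 'a" where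
  "lagrange_weight A x = (\<Prod>y\<in>A - {x}. y / (y - x))"

lemma lagrange_weight_insert_old:
  assumes "finite A" "m \<notin> A" "x \<in> A"
  shows "lagrange_weight (insert m A) x = lagrange_weight A x * (m / (m - x))"
proof -
  have "insert m A - {x} = insert m (A - {x})" using assms by auto
  then show ?thesis
    using assms by (simp add: lagrange_weight_def mult.commute)
qed

lemma lagrange_weight_insert_new:
  assumes "m \<notin> A"
  shows "lagrange_weight (insert m A) m = (\<Prod>x\<in>A. x / (x - m))"
  using assms by (simp add: lagrange_weight_def)

text \<open>Induction on the set. A new element \<open>m\<close> receives the coefficient \<open>\<Prod> x / (x - m)\<close>, which the
  induction hypothesis expands at \<open>z = -m\<close>; this is why \<open>z\<close> may be any value that is not a pole, and
  not only a nonnegative one.\<close>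

lemma partial_fractions:
  fixes z :: "'a::field"
  assumes "finite A" "A \<noteq> {}" "\<And>x. x \<in> A \<Longrightarrow> x + z \<noteq> 0"
  shows "(\<Sum>x\<in>A. lagrange_weight A x * (x / (x + z))) = (\<Prod>x\<in>A. x / (x + z))"
  using assms
proof (induction A arbitrary: z rule: finite_ne_induct)
  case (singleton x)
  then show ?case by (simp add: lagrange_weight_def)
next
  case (insert m A)
  have ne: "m - x \<noteq> 0" if "x \<in> A" for x using that insert.hyps by auto
  have mz: "m + z \<noteq> 0" and xz: "\<And>x. x \<in> A \<Longrightarrow> x + z \<noteq> 0" using insert.prems by auto
  have xm: "x + - m \<noteq> 0" if "x \<in> A" for x using ne[OF that] by auto
  have IHm: "(\<Sum>x\<in>A. lagrange_weight A x * (x / (x + - m))) = (\<Prod>x\<in>A. x / (x + - m))"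
    by (rule insert.IH) (rule xm)
  have IHz: "(\<Sum>x\<in>A. lagrange_weight A x * (x / (x + z))) = (\<Prod>x\<in>A. x / (x + z))"
    by (rule insert.IH) (rule xz)
  \<comment> \<open>Partial fractions in \<open>z\<close> of one summand with the two poles \<open>-x\<close> and \<open>-m\<close>.\<close>
  have split: "lagrange_weight A x * (m / (m - x)) * (x / (x + z)) =
      m / (m + z) * (lagrange_weight A x * (x / (x + z)) - lagrange_weight A x * (x / (x + - m)))"
    if "x \<in> A" for x
  proof -
    have "m * x / ((m - x) * (x + z)) = m / (m + z) * (x / (x + z) - x / (x + - m))"
      using ne[OF that] xz[OF that] mz xm[OF that] by (simp add: divide_simps) (rule disjI2, simp add: algebra_simps)
    moreover have "L * (m / (m - x)) * (x / (x + z)) = L * (m * x / ((m - x) * (x + z)))" for L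
      by simp
    ultimately show ?thesis by (simp only: right_diff_distrib mult_ac)
  qed
  have "(\<Sum>x\<in>A. lagrange_weight (insert m A) x * (x / (x + z))) =
        (\<Sum>x\<in>A. lagrange_weight A x * (m / (m - x)) * (x / (x + z)))"
    using insert.hyps by (intro sum.cong) (auto simp: lagrange_weight_insert_old)
  also have "\<dots> = m / (m + z) * ((\<Prod>x\<in>A. x / (x + z)) - (\<Prod>x\<in>A. x / (x + - m)))"
    unfolding IHz[symmetric] IHm[symmetric] sum_subtractf[symmetric] sum_distrib_left
    by (intro sum.cong refl split)
  finally show ?case
    using insert.hyps by (simp add: lagrange_weight_insert_new algebra_simps)
qed

text \<open>The hypoexponential density: the density at \<open>u \<ge> 0\<close> of a sum of independent exponential variables
  whose rates are the elements of \<open>A\<close>, written as a combination of exponentials.\<close>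

definition hypoexp_density :: "real set \<Rightarrow> real \<Rightarrow> real" where
  "hypoexp_density A u = (\<Sum>x\<in>A. lagrange_weight A x * x * exp (- (x * u)))"

lemma hypoexp_density_measurable [measurable]: "hypoexp_density A \<in> borel_measurable borel"
  unfolding hypoexp_density_def[abs_def] by measurable

text \<open>The initial value that the differential equation in the next lemma needs; it is the partial fraction
  identity at \<open>z = -m\<close>.\<close>

lemma hypoexp_density_insert_0:
  assumes "finite A" "A \<noteq> {}" "m \<notin> A"
  shows "hypoexp_density (insert m A) 0 = 0"
proof -
  have ne: "m - x \<noteq> 0" "x + - m \<noteq> 0" if "x \<in> A" for x using that assms by auto
  have "(\<Sum>x\<in>A. lagrange_weight (insert m A) x * x) =
      (\<Sum>x\<in>A. - m * (lagrange_weight A x * (x / (x + - m))))"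
  proof (intro sum.cong refl)
    fix x assume x: "x \<in> A"
    have "m / (m - x) = - (m / (x + - m))" using ne[OF x] by (simp add: divide_simps) (simp add: algebra_simps)
    then show "lagrange_weight (insert m A) x * x = - m * (lagrange_weight A x * (x / (x + - m)))"
      using assms x by (simp add: lagrange_weight_insert_old)
  qed
  also have "\<dots> = - m * (\<Prod>x\<in>A. x / (x + - m))"
    unfolding sum_distrib_left[symmetric] using assms ne by (subst partial_fractions) auto
  finally show ?thesis
    using assms by (simp add: hypoexp_density_def lagrange_weight_insert_new)
qed

text \<open>Adding an exponential variable of rate \<open>m\<close> convolves the density \<open>f\<close> with \<open>m exp (-m u)\<close>, so the new
  density \<open>g\<close> solves \<open>g' + m g = m f\<close> with \<open>g 0 = 0\<close>. Equivalently, \<open>exp (m u) g(u)\<close> starts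
  at \<open>0\<close> and has the derivative \<open>m exp (m u) f(u)\<close>, which is nonnegative by induction.\<close>

lemma hypoexp_density_nonneg:
  assumes "finite A" "A \<noteq> {}" "\<And>x. x \<in> A \<Longrightarrow> 0 < x" "0 \<le> u"
  shows "0 \<le> hypoexp_density A u"
  using assms
proof (induction A arbitrary: u rule: finite_ne_induct)
  case (singleton x)
  then show ?case by (simp add: hypoexp_density_def lagrange_weight_def)
next
  case (insert m A)
  have ne: "m - x \<noteq> 0" if "x \<in> A" for x using that insert.hyps by auto
  \<comment> \<open>The integrating factor \<open>exp (m u)\<close> turns the differential equation into a formula for the derivative.\<close>
  define g where "g = (\<lambda>u. exp (m * u) * hypoexp_density (insert m A) u)"
  have expand: "g = (\<lambda>u. lagrange_weight (insert m A) m * m +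
      (\<Sum>x\<in>A. lagrange_weight A x * x * (m / (m - x)) * exp ((m - x) * u)))"
    using insert.hyps
    by (auto simp: g_def hypoexp_density_def lagrange_weight_insert_old sum_distrib_left
        distrib_left exp_minus field_simps exp_diff intro!: sum.cong)
  have deriv: "(g has_real_derivative m * exp (m * u) * hypoexp_density A u) (at u)" for u
  proof -
    have exp_deriv: "((\<lambda>u. c * exp ((m - x) * u)) has_real_derivative c * (exp ((m - x) * u) * (m - x))) (at u)"
      for c x by (auto intro!: derivative_eq_intros)
    have "(g has_real_derivative 0 +
        (\<Sum>x\<in>A. lagrange_weight A x * x * (m / (m - x)) * (exp ((m - x) * u) * (m - x)))) (at u)"
      unfolding expand by (intro DERIV_add DERIV_const DERIV_sum exp_deriv)
    also have "0 + (\<Sum>x\<in>A. lagrange_weight A x * x * (m / (m - x)) * (exp ((m - x) * u) * (m - x))) =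
        m * exp (m * u) * hypoexp_density A u"
      unfolding hypoexp_density_def sum_distrib_left add_0_left
    proof (intro sum.cong refl)
      fix x assume x: "x \<in> A"
      have "m / (m - x) * (m - x) = m" using ne[OF x] by simp
      moreover have "exp ((m - x) * u) = exp (m * u) * exp (- (x * u))"
        by (simp add: exp_add[symmetric] algebra_simps)
      moreover have "L * x * c * (E * d) = (c * d) * E * (L * x)" for L c E d :: real
        by (simp only: mult_ac)
      ultimately show "lagrange_weight A x * x * (m / (m - x)) * (exp ((m - x) * u) * (m - x)) =
          m * exp (m * u) * (lagrange_weight A x * x * exp (- (x * u)))"
        by (metis mult.assoc mult.commute)
    qed
    finally show ?thesis .
  qed
  have "g 0 \<le> g u"
  proof (rule DERIV_nonneg_imp_nondecreasing[OF insert.prems(2)])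
    fix v assume "0 \<le> v" "v \<le> u"
    then have "0 \<le> m * exp (m * v) * hypoexp_density A v"
      using insert by (intro mult_nonneg_nonneg) (auto intro: less_imp_le)
    with deriv show "\<exists>y. (g has_real_derivative y) (at v) \<and> 0 \<le> y" by blast
  qed
  moreover have "g 0 = 0" using insert.hyps by (simp add: g_def hypoexp_density_insert_0)
  ultimately show ?case by (simp add: g_def zero_le_mult_iff)
qed

section \<open>Absolute convergence of the Ohno series\<close>

lemma increasing_tuplesD:
  assumes "ns \<in> increasing_tuples r"
  shows "length ns = r" "\<And>j. j < r \<Longrightarrow> 0 < ns ! j" "\<And>i j. i < j \<Longrightarrow> j < r \<Longrightarrow> ns ! i < ns ! j"
  using assms by (auto simp: increasing_tuples_def sorted_wrt_iff_nth_less)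

lemma increasing_tuples_nth_eq_iff:
  assumes "ns \<in> increasing_tuples r" "i < r" "j < r"
  shows "ns ! i = ns ! j \<longleftrightarrow> i = j"
  using increasing_tuplesD(3)[OF assms(1), of i j] increasing_tuplesD(3)[OF assms(1), of j i] assms
  by (cases i j rule: linorder_cases) auto

text \<open>For fixed \<open>i\<close>, an increasing tuple is determined by \<open>n\<^sub>i\<close> and the distances of the other entries
  to \<open>n\<^sub>i\<close>. In these coordinates the terms of the Ohno series are dominated by a product of functions of
  one variable each.\<close>

definition gap_coords :: "nat \<Rightarrow> nat \<Rightarrow> nat list \<Rightarrow> nat \<Rightarrow> nat" where
  "gap_coords r i ns = (\<lambda>j\<in>{..<r}. if j = i then ns ! i else nat \<bar>int (ns ! j) - int (ns ! i)\<bar>)"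

lemma inj_on_gap_coords:
  assumes "i < r"
  shows "inj_on (gap_coords r i) (increasing_tuples r)"
proof (rule inj_onI)
  fix ns ms assume ns: "ns \<in> increasing_tuples r" and ms: "ms \<in> increasing_tuples r"
    and eq: "gap_coords r i ns = gap_coords r i ms"
  have eqj: "gap_coords r i ns j = gap_coords r i ms j" for j using eq by simp
  have i: "ns ! i = ms ! i" using eqj[of i] assms by (simp add: gap_coords_def)
  show "ns = ms"
  proof (rule nth_equalityI)
    show "length ns = length ms" using ns ms by (simp add: increasing_tuplesD)
    fix j assume "j < length ns"
    then have j: "j < r" using ns by (simp add: increasing_tuplesD)
    show "ns ! j = ms ! j"
    proof (cases i j rule: linorder_cases)
      case less
      then show ?thesis using eqj[of j] j i increasing_tuplesD(3)[OF ns less j] increasing_tuplesD(3)[OF ms less j]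
        by (simp add: gap_coords_def)
    next
      case greater
      then show ?thesis using eqj[of j] j i increasing_tuplesD(3)[OF ns greater assms] increasing_tuplesD(3)[OF ms greater assms]
        by (simp add: gap_coords_def)
    qed (use i in simp)
  qed
qed

lemma summable_on_prod_powr:
  fixes p :: "'a \<Rightarrow> real"
  assumes "finite A" "\<And>j. j \<in> A \<Longrightarrow> 1 < p j"
  shows "(\<lambda>g. \<Prod>j\<in>A. real (g j) powr (- p j)) summable_on (PiE A (\<lambda>_. UNIV))"
proof -
  have "Infinite_Set_Sum.abs_summable_on (\<lambda>g. \<Prod>j\<in>A. real (g j) powr (- p j)) (PiE A (\<lambda>_. UNIV :: nat set))"
    using assms by (intro abs_summable_on_prod_PiE)
      (auto simp: abs_summable_on_nat_iff' summable_real_powr_iff)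
  then show ?thesis by (rule abs_summable_summable[OF abs_summable_equivalent[THEN iffD2]])
qed

text \<open>Since \<open>k\<close> is bounded below by \<open>(1, \<dots>, 1, 2)\<close>, the term is at most
  \<open>n\<^sub>i\<^bsup>-1-Re s\<^esup> n\<^sub>r\<^bsup>-1\<^esup> \<Prod>\<^bsub>j \<noteq> i\<^esub> 1 / \<bar>n\<^sub>j - n\<^sub>i\<bar>\<close>. The largest entry \<open>n\<^sub>r\<close> dominates every one of the new
  coordinates, so its reciprocal can be distributed over them with arbitrary nonnegative weights of
  total mass one.\<close>

lemma norm_Ohno_term_le:
  assumes ks: "\<And>j. j < length ks \<Longrightarrow> 1 \<le> ks ! j" "2 \<le> ks ! (length ks - 1)"
    and i: "i < length ks" and ns: "ns \<in> increasing_tuples (length ks)"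
    and w: "\<And>j. j < length ks \<Longrightarrow> 0 \<le> w j" "(\<Sum>j<length ks. w j) = 1"
  shows "norm (Ohno_term ks s i ns) \<le>
    (\<Prod>j<length ks. real (gap_coords (length ks) i ns j) powr (- (if j = i then 1 + Re s + w i else 1 + w j)))"
proof -
  define r where "r = length ks"
  define N where "N = real (ns ! (r - 1))"
  define m where "m = (\<lambda>j. real (gap_coords r i ns j))"
  have r: "0 < r" "i < r" using i by (auto simp: r_def)
  note nsD = increasing_tuplesD[OF ns[folded r_def]]
  have npos: "0 < real (ns ! j)" if "j < r" for j using nsD(2)[OF that] by simp
  have N1: "0 < N" using npos[of "r - 1"] r by (simp add: N_def)
  have le_N: "real (ns ! j) \<le> N" if "j < r" for j
    using nsD(3)[of j "r - 1"] that by (cases "j = r - 1") (auto simp: N_def intro: less_imp_le)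
  have m_i: "m i = real (ns ! i)" using r by (simp add: m_def gap_coords_def)
  have m_j: "m j = \<bar>real (ns ! j) - real (ns ! i)\<bar>" if "j < r" "j \<noteq> i" for j
    using that by (simp add: m_def gap_coords_def)
  have m_pos: "0 < m j" if "j < r" for j
    using npos[OF that] increasing_tuples_nth_eq_iff[OF ns[folded r_def], of i j] that r
    by (cases "j = i") (auto simp: m_i m_j)
  have m_le: "m j \<le> N" if "j < r" for j
    using le_N[OF that] le_N[OF r(2)] npos[OF that] npos[OF r(2)] that
    by (cases "j = i") (auto simp: m_i m_j)
  have prod_split: "(\<Prod>j<r. F j) = F i * (\<Prod>j\<in>{..<r} - {i}. F j)" for F :: "nat \<Rightarrow> real"
    using r by (intro prod.remove) auto
  have prod_ge: "(\<Prod>j<r. real (ns ! j)) * N \<le> (\<Prod>j<r. real (ns ! j) ^ (ks ! j))"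
  proof -
    have e: "{..<r} = insert (r - 1) {..<r - 1}" using r by auto
    have ge1: "1 \<le> real (ns ! j)" if "j < r" for j using npos[OF that] by simp
    have "(\<Prod>j<r. real (ns ! j)) * N = (\<Prod>j<r - 1. real (ns ! j)) * N ^ 2"
      by (subst e) (simp add: N_def power2_eq_square)
    also have "\<dots> \<le> (\<Prod>j<r - 1. real (ns ! j) ^ (ks ! j)) * N ^ (ks ! (r - 1))"
    proof (intro mult_mono prod_mono conjI)
      fix j assume "j \<in> {..<r - 1}"
      then have j: "j < r" by auto
      show "real (ns ! j) \<le> real (ns ! j) ^ (ks ! j)"
        using ge1[OF j] ks(1)[OF j[unfolded r_def]] by (intro self_le_power) auto
    qed (use N1 ge1[of "r - 1"] r ks(2) in \<open>auto intro!: prod_nonneg power_increasing simp: N_def r_def\<close>)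
    also have "\<dots> = (\<Prod>j<r. real (ns ! j) ^ (ks ! j))"
      by (subst e) (simp add: N_def)
    finally show ?thesis .
  qed
  have "norm (Ohno_term ks s i ns) =
      1 / (\<Prod>j<r. real (ns ! j) ^ (ks ! j)) * real (ns ! i) powr (- Re s) * (\<Prod>j\<in>{..<r} - {i}. real (ns ! j) / m j)"
  proof -
    have nrm: "norm (of_nat (ns ! j) / (of_nat (ns ! j) - of_nat (ns ! i)) :: complex) = real (ns ! j) / m j"
      if "j \<in> {..<r} - {i}" for j
    proof -
      have "(of_nat (ns ! j) - of_nat (ns ! i) :: complex) = of_real (real (ns ! j) - real (ns ! i))" by simp
      then have "norm (of_nat (ns ! j) - of_nat (ns ! i) :: complex) = \<bar>real (ns ! j) - real (ns ! i)\<bar>"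
        by (simp only: norm_of_real)
      then show ?thesis using that by (simp add: norm_divide m_j)
    qed
    have pw: "norm (of_nat (ns ! i) powr s :: complex) = real (ns ! i) powr Re s"
      using norm_powr_real_powr[of "of_nat (ns ! i)" s] by simp
    have "norm (1 / (\<Prod>j<r. of_nat (ns ! j) ^ (ks ! j)) :: complex) = 1 / (\<Prod>j<r. real (ns ! j) ^ (ks ! j))"
      by (simp add: norm_divide norm_power prod_norm[symmetric])
    moreover have "norm (1 / of_nat (ns ! i) powr s :: complex) = real (ns ! i) powr (- Re s)"
      by (simp add: norm_divide pw powr_minus_divide)
    moreover have "norm (\<Prod>j\<in>{..<r} - {i}. of_nat (ns ! j) / (of_nat (ns ! j) - of_nat (ns ! i)) :: complex) =
        (\<Prod>j\<in>{..<r} - {i}. real (ns ! j) / m j)"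
      unfolding prod_norm[symmetric] by (intro prod.cong refl nrm)
    ultimately show ?thesis
      unfolding Ohno_term_def norm_mult r_def[symmetric] by simp
  qed
  also have "\<dots> \<le> 1 / ((\<Prod>j<r. real (ns ! j)) * N) * real (ns ! i) powr (- Re s) * (\<Prod>j\<in>{..<r} - {i}. real (ns ! j) / m j)"
  proof (intro mult_right_mono divide_left_mono prod_ge)
    show "0 < (\<Prod>j<r. real (ns ! j) ^ (ks ! j)) * ((\<Prod>j<r. real (ns ! j)) * N)"
      using npos N1 by (intro mult_pos_pos prod_pos) auto
  qed (auto intro!: prod_nonneg simp: m_def)
  also have "\<dots> = 1 / N * (real (ns ! i) powr (- Re s) / real (ns ! i)) * (\<Prod>j\<in>{..<r} - {i}. 1 / m j)"
  proof -
    have "(\<Prod>j<r. real (ns ! j)) = real (ns ! i) * (\<Prod>j\<in>{..<r} - {i}. real (ns ! j))"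
      by (rule prod_split)
    moreover have "(\<Prod>j\<in>{..<r} - {i}. real (ns ! j)) \<noteq> 0"
      using npos by fastforce
    moreover have "1 / (x * P * N) * y * (P / M) = 1 / N * (y / x) * (1 / M)" if "P \<noteq> 0" for x y P N M :: real
      using that by simp
    ultimately show ?thesis by (simp only: prod_dividef prod.neutral_const)
  qed
  also have "\<dots> \<le> (\<Prod>j<r. m j powr (- w j)) * (real (ns ! i) powr (- Re s) / real (ns ! i)) * (\<Prod>j\<in>{..<r} - {i}. 1 / m j)"
  proof (intro mult_right_mono)
    have "1 / N = N powr (\<Sum>j<r. - w j)"
      using w(2) N1 by (simp add: r_def sum_negf powr_minus_divide)
    also have "\<dots> = (\<Prod>j<r. N powr (- w j))" using N1 by (subst powr_sum) auto
    also have "\<dots> \<le> (\<Prod>j<r. m j powr (- w j))"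
      using m_pos m_le w(1) by (intro prod_mono) (auto simp: r_def intro!: powr_mono2')
    finally show "1 / N \<le> (\<Prod>j<r. m j powr (- w j))" .
  qed (auto intro!: prod_nonneg simp: m_def)
  also have "\<dots> = (\<Prod>j<r. m j powr (- (if j = i then 1 + Re s + w i else 1 + w j)))"
  proof -
    have "(\<Prod>j<r. m j powr (- w j)) = m i powr (- w i) * (\<Prod>j\<in>{..<r} - {i}. m j powr (- w j))"
      by (rule prod_split)
    moreover have "(\<Prod>j<r. m j powr (- (if j = i then 1 + Re s + w i else 1 + w j))) =
        m i powr (- (1 + Re s + w i)) * (\<Prod>j\<in>{..<r} - {i}. m j powr (- (1 + w j)))"
      unfolding prod_split[of "\<lambda>j. m j powr (- (if j = i then 1 + Re s + w i else 1 + w j))"] by simp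
    moreover have "(\<Prod>j\<in>{..<r} - {i}. m j powr (- (1 + w j))) =
        (\<Prod>j\<in>{..<r} - {i}. m j powr (- w j)) * (\<Prod>j\<in>{..<r} - {i}. 1 / m j)"
      unfolding prod.distrib[symmetric]
    proof (intro prod.cong refl)
      fix j assume "j \<in> {..<r} - {i}"
      then have "0 < m j" using m_pos by auto
      moreover have "- (1 + w j) = - w j + - 1" by simp
      ultimately show "m j powr (- (1 + w j)) = m j powr (- w j) * (1 / m j)"
        by (simp only: powr_add powr_neg_one)
    qed
    moreover have "m i powr (- (1 + Re s + w i)) = m i powr (- w i) * (m i powr (- Re s) / m i)"
      using m_pos[OF r(2)] by (simp add: powr_add powr_minus powr_diff field_simps)
    ultimately show ?thesis unfolding m_i by simp
  qed
  finally show ?thesis by (simp add: m_def r_def)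
qed

text \<open>Give a small weight \<open>e\<close> to each gap and the rest to \<open>n\<^sub>i\<close>. The slack \<open>1 + Re s > 0\<close>
  leaves room for this: every variable gets an exponent greater than one, and the dominating product
  is summable over all coordinates.\<close>

lemma Ohno_term_abs_summable:
  assumes ks: "\<And>j. j < length ks \<Longrightarrow> 1 \<le> ks ! j" "2 \<le> ks ! (length ks - 1)"
    and i: "i < length ks" and s: "- 1 < Re s"
  shows "(\<lambda>ns. norm (Ohno_term ks s i ns)) summable_on increasing_tuples (length ks)"
proof -
  define r where "r = length ks"
  \<comment> \<open>The gaps take at most half of the total mass and at most half of the slack \<open>1 + Re s\<close>.\<close>
  define e where "e = min 1 (1 + Re s) / (2 * real r)"
  define w where "w = (\<lambda>j. if j = i then 1 - real (r - 1) * e else e)"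
  define p where "p = (\<lambda>j. if j = i then 1 + Re s + w i else 1 + w j)"
  have r: "0 < r" "i < r" using i by (auto simp: r_def)
  have e: "0 < e" using s r by (simp add: e_def)
  have "real (r - 1) * e \<le> real r * e" using e by (intro mult_right_mono) auto
  also have "\<dots> = min 1 (1 + Re s) / 2" using r by (simp add: e_def)
  finally have re: "real (r - 1) * e \<le> 1 / 2" "real (r - 1) * e \<le> (1 + Re s) / 2" by auto
  have "(\<Sum>j<r. w j) = w i + (\<Sum>j\<in>{..<r} - {i}. w j)" using r by (intro sum.remove) auto
  also have "(\<Sum>j\<in>{..<r} - {i}. w j) = (\<Sum>j\<in>{..<r} - {i}. e)" by (intro sum.cong) (auto simp: w_def)
  finally have "(\<Sum>j<r. w j) = w i + (\<Sum>j\<in>{..<r} - {i}. e)" .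
  then have w1: "(\<Sum>j<r. w j) = 1" using r by (simp add: w_def)
  have w0: "0 \<le> w j" for j using e re by (simp add: w_def)
  have p: "1 < p j" for j using e re s by (simp add: p_def w_def)
  have "(\<lambda>g. \<Prod>j\<in>{..<r}. real (g j) powr (- p j)) summable_on (gap_coords r i ` increasing_tuples r)"
    by (rule summable_on_subset_banach[OF summable_on_prod_powr]) (auto simp: p gap_coords_def restrict_def PiE_def extensional_def)
  then have "(\<lambda>ns. \<Prod>j<r. real (gap_coords r i ns j) powr (- p j)) summable_on increasing_tuples r"
    by (subst (asm) summable_on_reindex[OF inj_on_gap_coords[OF r(2)]]) (simp add: comp_def)
  then show ?thesis
    unfolding r_def
    by (rule summable_on_comparison_test)
       (use norm_Ohno_term_le[OF ks i, of _ w s] w0 w1 in \<open>auto simp: p_def r_def\<close>)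
qed

section \<open>Measures determined by their Laplace transform\<close>

text \<open>On a bounded interval the moments determine the law, because the Taylor polynomials of the
  characteristic function converge to it.\<close>

lemma real_distribution_eqI_moments:
  fixes M1 M2 :: "real measure"
  assumes "real_distribution M1" "real_distribution M2"
    and bd1: "AE x in M1. \<bar>x\<bar> \<le> 1" and bd2: "AE x in M2. \<bar>x\<bar> \<le> 1"
    and eq: "\<And>k::nat. (\<integral>x. x ^ k \<partial>M1) = (\<integral>x. x ^ k \<partial>M2)"
  shows "M1 = M2"
proof (rule Levy_uniqueness[OF assms(1,2)], rule ext)
  fix t :: real
  have approx: "cmod (char M t - (\<Sum>k\<le>n. ((\<i> * t)^k / fact k) * (\<integral>x. x ^ k \<partial>M))) \<le> 2 * \<bar>t\<bar>^n / fact n"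
    if "real_distribution M" "AE x in M. \<bar>x\<bar> \<le> 1" for M :: "real measure" and n
  proof -
    interpret real_distribution M by fact
    have int: "integrable M (\<lambda>x. x ^ k)" for k
      by (rule integrable_const_bound[where B=1]) (use that(2) in \<open>auto elim!: eventually_mono simp: power_le_one power_abs\<close>)
    have "expectation (\<lambda>x. \<bar>x\<bar> ^ n) \<le> expectation (\<lambda>x. 1)"
      using that(2) integrable_abs[OF int[of n]]
      by (intro integral_mono_AE) (auto elim!: eventually_mono simp: power_le_one power_abs)
    also have "expectation (\<lambda>x. 1 :: real) = 1" using prob_space by simp
    finally have "(2*\<bar>t\<bar>^n / fact n) * expectation (\<lambda>x. \<bar>x\<bar>^n) \<le> (2*\<bar>t\<bar>^n / fact n) * 1"
      by (intro mult_left_mono) auto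
    with char_approx1[of n t] int show ?thesis by force
  qed
  have "cmod (char M1 t - char M2 t) \<le> 2 * (2 * \<bar>t\<bar>^n / fact n)" for n
    using norm_triangle_le_diff[OF add_mono[OF approx[OF assms(1) bd1, of n] approx[OF assms(2) bd2, of n]]]
    by (simp add: eq)
  moreover have "(\<lambda>n. 2 * (2 * \<bar>t\<bar>^n / fact n)) \<longlonglongrightarrow> 2 * (2 * 0)"
    using tendsto_mult[OF tendsto_const[of "2::real"] tendsto_mult[OF tendsto_const[of "2::real"] summable_LIMSEQ_zero[OF summable_exp[of "\<bar>t\<bar>"]]]]
    by (simp add: field_simps)
  ultimately have "cmod (char M1 t - char M2 t) \<le> 0"
    by (intro LIMSEQ_le_const[of "\<lambda>n. 2 * (2 * \<bar>t\<bar>^n / fact n)"]) auto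
  then show "char M1 t = char M2 t" by simp
qed

text \<open>The substitution \<open>y = exp (-x)\<close> moves the measures to the unit interval and turns the values of the
  Laplace transform at the natural numbers into moments. Dividing by the total mass, which is the
  transform at \<open>0\<close>, reduces the claim to probability measures.\<close>

lemma measure_eqI_laplace:
  fixes M1 M2 :: "real measure"
  assumes sets: "sets M1 = sets borel" "sets M2 = sets borel"
    and pos1: "AE x in M1. 0 \<le> x" and pos2: "AE x in M2. 0 \<le> x"
    and eq: "\<And>N::nat. (\<integral>\<^sup>+x. exp (- (real N * x)) \<partial>M1) = (\<integral>\<^sup>+x. exp (- (real N * x)) \<partial>M2)"
    and fin: "emeasure M1 (space M1) < \<infinity>"
  shows "M1 = M2"
proof (cases "emeasure M1 (space M1) = 0")
  case True
  have "emeasure M2 (space M2) = 0" using eq[of 0] True by simp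
  then have "emeasure M1 A = 0" "emeasure M2 A = 0" for A
    using True emeasure_space[of M1 A] emeasure_space[of M2 A] by simp_all
  then show ?thesis by (intro measure_eqI) (auto simp: sets)
next
  case False
  define c where "c = emeasure M1 (space M1)"
  have c: "c \<noteq> 0" "c \<noteq> \<infinity>" using False fin by (auto simp: c_def)
  have c2: "emeasure M2 (space M2) = c" using eq[of 0] by (simp add: c_def)
  note [measurable_cong] = sets
  define P where "P = (\<lambda>M :: real measure. distr (scale_measure (1 / c) M) borel (\<lambda>x. exp (- x)))"
  have P: "real_distribution (P M) \<and> (AE x in P M. \<bar>x\<bar> \<le> 1) \<and>
      (\<forall>k. (\<integral>x. x ^ k \<partial>P M) = enn2real (1 / c * (\<integral>\<^sup>+x. exp (- (real k * x)) \<partial>M)))"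
    if s: "sets M = sets borel" and pos: "AE x in M. 0 \<le> x" and cM: "emeasure M (space M) = c" for M
  proof -
    note [measurable_cong] = s
    have spM: "space M = UNIV" using sets_eq_imp_space_eq[OF s] by simp
    have one: "1 / c * c = 1" using c by (simp add: ennreal_divide_times ennreal_divide_self less_top[symmetric])
    have "prob_space (scale_measure (1 / c) M)"
      by standard (simp add: emeasure_scale_measure space_scale_measure cM one)
    then interpret Q: prob_space "scale_measure (1 / c) M" .
    have mexp[measurable]: "(\<lambda>x. exp (- x)) \<in> borel_measurable (scale_measure (1 / c) M)" by measurable
    have rd: "real_distribution (P M)" unfolding P_def by (rule Q.real_distribution_distr) fact
    have ae: "AE x in scale_measure (1 / c) M. 0 \<le> x"
    proof -
      have "{x \<in> space M. \<not> 0 \<le> x} \<in> sets M" by measurable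
      moreover have "emeasure M {x \<in> space M. \<not> 0 \<le> x} = 0"
        using pos calculation by (simp add: AE_iff_measurable[OF _ refl])
      ultimately show ?thesis
        by (subst AE_iff_measurable[OF _ refl]) (auto simp: space_scale_measure)
    qed
    have aeP: "AE x in P M. \<bar>x\<bar> \<le> 1"
      unfolding P_def by (subst AE_distr_iff) (use ae in \<open>auto elim!: eventually_mono\<close>)
    have "(\<integral>x. x ^ k \<partial>P M) = enn2real (1 / c * (\<integral>\<^sup>+x. exp (- (real k * x)) \<partial>M))" for k
    proof -
      have "(\<integral>x. x ^ k \<partial>P M) = (\<integral>x. exp (- (real k * x)) \<partial>scale_measure (1 / c) M)"
        unfolding P_def by (subst integral_distr) (auto simp: exp_of_nat_mult[symmetric])
      also have "\<dots> = enn2real (\<integral>\<^sup>+x. exp (- (real k * x)) \<partial>scale_measure (1 / c) M)"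
        by (rule integral_eq_nn_integral) auto
      finally show ?thesis by (simp add: nn_integral_scale_measure)
    qed
    then show ?thesis using rd aeP by auto
  qed
  note P1 = P[OF sets(1) pos1 c_def[symmetric]] and P2 = P[OF sets(2) pos2 c2]
  have "P M1 = P M2"
    by (rule real_distribution_eqI_moments) (use P1 P2 eq in auto)
  have recover: "scale_measure c (distr (P M) borel (\<lambda>x. - ln x)) = M" if s: "sets M = sets borel" for M
  proof -
    note [measurable_cong] = s
    have *: "distr (P M) borel (\<lambda>x. - ln x) = distr (scale_measure (1 / c) M) borel (\<lambda>x. x)"
      unfolding P_def by (subst distr_distr) (auto simp: comp_def)
    have **: "distr (scale_measure (1 / c) M) borel (\<lambda>x. x) = scale_measure (1 / c) M"
      by (rule distr_id2) (simp add: s)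
    have "c * (1 / c) = 1" using c by (simp add: ennreal_times_divide less_top[symmetric])
    then show ?thesis unfolding * ** by simp
  qed
  show ?thesis
    by (rule trans[OF recover[OF sets(1), symmetric, unfolded \<open>P M1 = P M2\<close>] recover[OF sets(2)]])
qed

section \<open>Iterated integrals and tail sums\<close>

text \<open>One layer of a nested sum: \<open>g\<close> is summed over all \<open>n > m\<close> with coefficients \<open>c n\<close>. The index
  shift makes it an ordinary series, for which measurability and the exchange with an integral are
  immediate.\<close>

definition tail_sum :: "(nat \<Rightarrow> real) \<Rightarrow> (nat \<Rightarrow> ennreal) \<Rightarrow> nat \<Rightarrow> ennreal" where
  "tail_sum c g m = (\<Sum>k. ennreal (c (Suc (m + k))) * g (Suc (m + k)))"

lemma tail_sum_cong:
  "(\<And>n. m < n \<Longrightarrow> ennreal (c n) * g n = ennreal (c' n) * g' n) \<Longrightarrow> tail_sum c g m = tail_sum c' g' m"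
  by (simp add: tail_sum_def)

lemma tail_sum_cmult: "tail_sum c (\<lambda>n. x * g n) m = x * tail_sum c g m"
  unfolding tail_sum_def by (subst ennreal_suminf_cmult[symmetric]) (simp add: mult_ac)

lemma funpow_tail_sum_cmult: "(tail_sum c ^^ a) (\<lambda>n. x * g n) m = x * (tail_sum c ^^ a) g m"
proof -
  have "(tail_sum c ^^ a) (\<lambda>n. x * g n) = (\<lambda>m. x * (tail_sum c ^^ a) g m)"
    by (induction a) (simp_all add: tail_sum_cmult)
  then show ?thesis by simp
qed

lemma tail_sum_measurable [measurable (raw)]:
  assumes [measurable]: "\<And>n. (\<lambda>t. F t n) \<in> borel_measurable M"
  shows "(\<lambda>t. tail_sum c (F t) m) \<in> borel_measurable M"
  unfolding tail_sum_def by measurable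

lemma funpow_tail_sum_measurable [measurable (raw)]:
  assumes [measurable]: "\<And>n. (\<lambda>t. F t n) \<in> borel_measurable M"
  shows "(\<lambda>t. (tail_sum c ^^ a) (F t) m) \<in> borel_measurable M"
  by (induction a arbitrary: m) simp_all

lemma nn_integral_tail_sum:
  assumes [measurable]: "\<And>n. (\<lambda>t. F t n) \<in> borel_measurable M"
  shows "(\<integral>\<^sup>+t. tail_sum c (F t) m \<partial>M) = tail_sum c (\<lambda>n. \<integral>\<^sup>+t. F t n \<partial>M) m"
  unfolding tail_sum_def by (subst nn_integral_suminf) (simp_all add: nn_integral_cmult)

lemma nn_integral_funpow_tail_sum:
  assumes [measurable]: "\<And>n. (\<lambda>t. F t n) \<in> borel_measurable M"
  shows "(\<integral>\<^sup>+t. (tail_sum c ^^ a) (F t) m \<partial>M) = (tail_sum c ^^ a) (\<lambda>n. \<integral>\<^sup>+t. F t n \<partial>M) m"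
  by (induction a arbitrary: m) (simp_all add: nn_integral_tail_sum)

lemma nn_integral_power_kernel:
  fixes H h :: "real \<Rightarrow> real"
  assumes [measurable]: "H \<in> borel_measurable borel" "h \<in> borel_measurable borel"
    and "x \<le> t"
    and H: "\<And>v. x \<le> v \<Longrightarrow> v \<le> t \<Longrightarrow> (H has_real_derivative h v) (at v)"
    and h: "\<And>v. x \<le> v \<Longrightarrow> v \<le> t \<Longrightarrow> 0 \<le> h v"
  shows "(\<integral>\<^sup>+v. ennreal (h v * ((H t - H v) ^ a / fact a)) * indicator {x<..<t} v \<partial>lborel) =
    ennreal ((H t - H x) ^ Suc a / fact (Suc a))"
proof -
  have mono: "H v \<le> H t" if "x \<le> v" "v \<le> t" for v
    by (rule DERIV_nonneg_imp_nondecreasing[OF that(2)]) (use H h that in \<open>meson order_trans\<close>)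
  define F where "F = (\<lambda>v. - ((H t - H v) ^ Suc a / fact (Suc a)))"
  have F: "(F has_real_derivative h v * ((H t - H v) ^ a / fact a)) (at v)" if "v \<in> {x..t}" for v
  proof -
    have "(F has_real_derivative - ((1 + real a) * ((0 - h v) * (H t - H v) ^ a) / fact (Suc a))) (at v)"
      unfolding F_def using that
      by (intro DERIV_minus DERIV_cdivide DERIV_power_Suc DERIV_diff DERIV_const H) auto
    also have "- ((1 + real a) * ((0 - h v) * (H t - H v) ^ a) / fact (Suc a)) = h v * ((H t - H v) ^ a / fact a)"
      unfolding fact_Suc by (simp add: divide_simps)
    finally show ?thesis .
  qed
  have "(\<integral>\<^sup>+v. ennreal (h v * ((H t - H v) ^ a / fact a)) * indicator {x<..<t} v \<partial>lborel) =
      (\<integral>\<^sup>+v. ennreal (h v * ((H t - H v) ^ a / fact a)) * indicator {x..t} v \<partial>lborel)"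
    using AE_lborel_singleton[of x] AE_lborel_singleton[of t]
    by (intro nn_integral_cong_AE) (auto split: split_indicator)
  also have "\<dots> = F t - F x"
    using F mono h \<open>x \<le> t\<close> by (intro nn_integral_FTC_Icc) auto
  finally show ?thesis by (simp add: F_def)
qed

text \<open>If \<open>H\<close> is a primitive of \<open>h\<close>, then \<open>(H t - H x)\<^sup>a / a!\<close> is the \<open>a\<close>-fold iterated integral of
  \<open>h\<close> between \<open>x\<close> and \<open>t\<close>. Splitting off the variable next to \<open>x\<close> gives a recursion in
  \<open>a\<close>. It serves both kernels of the simplex integral: \<open>h v = 1 / v\<close> and
  \<open>h v = 1 / (1 - v)\<close>.\<close>

lemma nn_integral_iterated_kernel:
  fixes H h :: "real \<Rightarrow> real" and \<phi> :: "real \<Rightarrow> ennreal"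
  assumes [measurable]: "H \<in> borel_measurable borel" "h \<in> borel_measurable borel" "\<phi> \<in> borel_measurable borel"
    and H: "\<And>v. 0 < v \<Longrightarrow> v \<le> t \<Longrightarrow> (H has_real_derivative h v) (at v)"
    and h: "\<And>v. 0 < v \<Longrightarrow> v \<le> t \<Longrightarrow> 0 \<le> h v"
  shows "(\<integral>\<^sup>+x. \<phi> x * ennreal ((H t - H x) ^ Suc a / fact (Suc a)) * indicator {0<..<t} x \<partial>lborel) =
    (\<integral>\<^sup>+v. (\<integral>\<^sup>+x. \<phi> x * indicator {0<..<v} x \<partial>lborel) * ennreal (h v * ((H t - H v) ^ a / fact a)) *
      indicator {0<..<t} v \<partial>lborel)"
proof -
  define K where "K = (\<lambda>v. ennreal (h v * ((H t - H v) ^ a / fact a)))"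
  have [measurable]: "K \<in> borel_measurable borel" unfolding K_def by measurable
  have "(\<integral>\<^sup>+x. \<phi> x * ennreal ((H t - H x) ^ Suc a / fact (Suc a)) * indicator {0<..<t} x \<partial>lborel) =
    (\<integral>\<^sup>+x. \<integral>\<^sup>+v. \<phi> x * K v * (if 0 < x \<and> x < v \<and> v < t then 1 else 0) \<partial>lborel \<partial>lborel)"
  proof (rule nn_integral_cong)
    fix x :: real
    show "\<phi> x * ennreal ((H t - H x) ^ Suc a / fact (Suc a)) * indicator {0<..<t} x =
      (\<integral>\<^sup>+v. \<phi> x * K v * (if 0 < x \<and> x < v \<and> v < t then 1 else 0) \<partial>lborel)"
    proof (cases "0 < x \<and> x < t")
      case True
      have "(\<integral>\<^sup>+v. \<phi> x * K v * (if 0 < x \<and> x < v \<and> v < t then 1 else 0) \<partial>lborel) =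
        (\<integral>\<^sup>+v. \<phi> x * (K v * indicator {x<..<t} v) \<partial>lborel)"
        using True by (intro nn_integral_cong) (auto split: split_indicator)
      also have "\<dots> = \<phi> x * ennreal ((H t - H x) ^ Suc a / fact (Suc a))"
      proof -
        have "(\<integral>\<^sup>+v. K v * indicator {x<..<t} v \<partial>lborel) = ennreal ((H t - H x) ^ Suc a / fact (Suc a))"
          unfolding K_def by (rule nn_integral_power_kernel) (use True H h in auto)
        then show ?thesis by (subst nn_integral_cmult) auto
      qed
      finally show ?thesis using True by simp
    qed (auto simp: nn_integral_0_iff_AE)
  qed
  also have "\<dots> = (\<integral>\<^sup>+v. \<integral>\<^sup>+x. \<phi> x * K v * (if 0 < x \<and> x < v \<and> v < t then 1 else 0) \<partial>lborel \<partial>lborel)"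
    by (rule lborel_pair.Fubini') measurable
  also have "\<dots> = (\<integral>\<^sup>+v. (\<integral>\<^sup>+x. (\<phi> x * indicator {0<..<v} x) * (K v * indicator {0<..<t} v) \<partial>lborel) \<partial>lborel)"
    by (intro nn_integral_cong) (auto split: split_indicator)
  also have "\<dots> = (\<integral>\<^sup>+v. (\<integral>\<^sup>+x. \<phi> x * indicator {0<..<v} x \<partial>lborel) * K v * indicator {0<..<t} v \<partial>lborel)"
    by (intro nn_integral_cong, subst nn_integral_multc) (auto simp: mult_ac)
  finally show ?thesis unfolding K_def .
qed

lemma nn_integral_power:
  assumes "0 \<le> t" "0 < n"
  shows "(\<integral>\<^sup>+x. ennreal (x ^ (n - 1)) * indicator {0<..<t} x \<partial>lborel) = ennreal (t ^ n / n)"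
proof -
  have "(\<integral>\<^sup>+x. ennreal (x ^ (n - 1)) * indicator {0<..<t} x \<partial>lborel) =
      (\<integral>\<^sup>+x. ennreal (x ^ (n - 1)) * indicator {0..t} x \<partial>lborel)"
  proof (rule nn_integral_cong_AE)
    show "AE x in lborel. ennreal (x ^ (n - 1)) * indicator {0<..<t} x = ennreal (x ^ (n - 1)) * indicator {0..t} x"
      using AE_lborel_singleton[of 0] AE_lborel_singleton[of t]
      by eventually_elim (auto split: split_indicator)
  qed
  also have "\<dots> = t ^ n / n - 0 ^ n / n"
    using assms by (intro nn_integral_FTC_Icc[where F="\<lambda>x. x ^ n / n"]) (auto intro!: derivative_eq_intros)
  finally show ?thesis using assms by (simp add: zero_power)
qed

text \<open>Every factor \<open>dv/v\<close> divides the coefficient of \<open>y\<^sup>n\<close> by \<open>n\<close>.\<close>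

lemma nn_integral_power_log_kernel:
  assumes "0 < y" "0 < n"
  shows "(\<integral>\<^sup>+t. ennreal (t ^ (n - 1)) * ennreal ((ln y - ln t) ^ b / fact b) * indicator {0<..<y} t \<partial>lborel) =
    ennreal (y ^ n / real n ^ Suc b)"
proof (induction b)
  case 0
  then show ?case using nn_integral_power[of y n] assms by simp
next
  case (Suc b)
  have "(\<integral>\<^sup>+t. ennreal (t ^ (n - 1)) * ennreal ((ln y - ln t) ^ Suc b / fact (Suc b)) * indicator {0<..<y} t \<partial>lborel) =
      (\<integral>\<^sup>+v. (\<integral>\<^sup>+x. ennreal (x ^ (n - 1)) * indicator {0<..<v} x \<partial>lborel) *
        ennreal (1 / v * ((ln y - ln v) ^ b / fact b)) * indicator {0<..<y} v \<partial>lborel)"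
    by (rule nn_integral_iterated_kernel) (auto intro!: derivative_eq_intros)
  also have "\<dots> = (\<integral>\<^sup>+v. ennreal (1 / n) * (ennreal (v ^ (n - 1)) * ennreal ((ln y - ln v) ^ b / fact b) *
      indicator {0<..<y} v) \<partial>lborel)"
  proof (rule nn_integral_cong)
    fix v :: real
    show "(\<integral>\<^sup>+x. ennreal (x ^ (n - 1)) * indicator {0<..<v} x \<partial>lborel) *
        ennreal (1 / v * ((ln y - ln v) ^ b / fact b)) * indicator {0<..<y} v =
      ennreal (1 / n) * (ennreal (v ^ (n - 1)) * ennreal ((ln y - ln v) ^ b / fact b) * indicator {0<..<y} v)"
    proof (cases "0 < v \<and> v < y")
      case True
      have "v ^ n = v * v ^ (n - 1)" using assms by (cases n) auto
      with True show ?thesis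
        using assms by (simp add: nn_integral_power ennreal_mult'[symmetric] del: One_nat_def)
    qed (auto split: split_indicator)
  qed
  also have "\<dots> = ennreal (1 / n) * ennreal (y ^ n / real n ^ Suc b)"
    unfolding Suc[symmetric] by (rule nn_integral_cmult) measurable
  also have "\<dots> = ennreal (y ^ n / real n ^ Suc (Suc b))"
    using assms by (simp add: ennreal_mult'[symmetric])
  finally show ?case .
qed

lemma geometric_tail_sum:
  assumes "0 < x" "x < 1"
  shows "ennreal (x ^ m / (1 - x)) = tail_sum (\<lambda>_. 1) (\<lambda>n. ennreal (x ^ (n - 1))) m"
proof -
  have "(\<lambda>k. x ^ m * x ^ k) sums (x ^ m * (1 / (1 - x)))"
    using assms by (intro sums_mult geometric_sums) auto
  then have "(\<Sum>k. ennreal (x ^ m * x ^ k)) = ennreal (x ^ m * (1 / (1 - x)))"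
    using assms by (intro suminf_ennreal_eq) auto
  then show ?thesis by (simp add: tail_sum_def power_add)
qed

abbreviation inv_shift :: "nat \<Rightarrow> nat \<Rightarrow> real" where
  "inv_shift N \<equiv> \<lambda>n. 1 / real (n + N)"

lemma tail_sum_shift:
  "tail_sum c g (m + N) = tail_sum (\<lambda>n. c (n + N)) (\<lambda>n. g (n + N)) m"
  by (simp add: tail_sum_def add_ac)

lemma nn_integral_power_geometric:
  assumes "0 < t" "t < 1"
  shows "(\<integral>\<^sup>+x. ennreal (x ^ (m + N) / (1 - x)) * indicator {0<..<t} x \<partial>lborel) =
    tail_sum (inv_shift N) (\<lambda>n. ennreal (t ^ (n + N))) m"
proof -
  have "(\<integral>\<^sup>+x. ennreal (x ^ (m + N) / (1 - x)) * indicator {0<..<t} x \<partial>lborel) =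
    (\<integral>\<^sup>+x. tail_sum (\<lambda>_. 1) (\<lambda>n. ennreal (x ^ (n + N - 1)) * indicator {0<..<t} x) m \<partial>lborel)"
  proof (rule nn_integral_cong)
    fix x :: real
    show "ennreal (x ^ (m + N) / (1 - x)) * indicator {0<..<t} x =
      tail_sum (\<lambda>_. 1) (\<lambda>n. ennreal (x ^ (n + N - 1)) * indicator {0<..<t} x) m"
    proof (cases "0 < x \<and> x < t")
      case True
      then show ?thesis
        using assms geometric_tail_sum[of x "m + N"] by (simp add: tail_sum_shift)
    qed (auto simp: tail_sum_def)
  qed
  also have "\<dots> = tail_sum (\<lambda>_. 1) (\<lambda>n. \<integral>\<^sup>+x. ennreal (x ^ (n + N - 1)) * indicator {0<..<t} x \<partial>lborel) m"
    by (rule nn_integral_tail_sum) measurable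
  also have "\<dots> = tail_sum (inv_shift N) (\<lambda>n. ennreal (t ^ (n + N))) m"
    using assms by (intro tail_sum_cong) (simp add: nn_integral_power ennreal_mult'[symmetric] del: One_nat_def)
  finally show ?thesis .
qed

text \<open>Every factor \<open>dv/(1-v)\<close> expands into a geometric series and adds one layer to the nested sum. The
  exponents are shifted by \<open>N\<close> because of the factor \<open>x\<^sup>N\<close> that comes from \<open>exp (-N L)\<close>.\<close>

lemma nn_integral_geometric_log_kernel:
  assumes "0 < t" "t < 1"
  shows "(\<integral>\<^sup>+x. ennreal (x ^ (m + N) / (1 - x)) * ennreal ((ln (1 - x) - ln (1 - t)) ^ a / fact a) *
      indicator {0<..<t} x \<partial>lborel) =
    (tail_sum (inv_shift N) ^^ Suc a) (\<lambda>n. ennreal (t ^ (n + N))) m"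
proof (induction a arbitrary: m)
  case 0
  then show ?case using nn_integral_power_geometric[of t m N] assms by simp
next
  case (Suc a)
  define K where "K = (\<lambda>v. ennreal ((ln (1 - v) - ln (1 - t)) ^ a / fact a))"
  have "(\<integral>\<^sup>+x. ennreal (x ^ (m + N) / (1 - x)) * ennreal ((ln (1 - x) - ln (1 - t)) ^ Suc a / fact (Suc a)) *
      indicator {0<..<t} x \<partial>lborel) =
    (\<integral>\<^sup>+v. (\<integral>\<^sup>+x. ennreal (x ^ (m + N) / (1 - x)) * indicator {0<..<v} x \<partial>lborel) *
      ennreal (1 / (1 - v) * ((ln (1 - v) - ln (1 - t)) ^ a / fact a)) * indicator {0<..<t} v \<partial>lborel)"
  proof -
    have "((\<lambda>v. - ln (1 - v)) has_real_derivative 1 / (1 - v)) (at v)" if "0 < v" "v \<le> t" for v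
      using that assms by (auto intro!: derivative_eq_intros)
    moreover have "- ln (1 - t) - - ln (1 - x) = ln (1 - x) - ln (1 - t)" for x by simp
    ultimately show ?thesis
      using nn_integral_iterated_kernel[where H="\<lambda>v. - ln (1 - v)" and h="\<lambda>v. 1 / (1 - v)" and a=a and t=t
        and \<phi>="\<lambda>x. ennreal (x ^ (m + N) / (1 - x))"] assms
      by simp
  qed
  also have "\<dots> = (\<integral>\<^sup>+v. tail_sum (inv_shift N)
      (\<lambda>n. ennreal (v ^ (n + N) / (1 - v)) * K v * indicator {0<..<t} v) m \<partial>lborel)"
  proof (rule nn_integral_cong)
    fix v :: real
    show "(\<integral>\<^sup>+x. ennreal (x ^ (m + N) / (1 - x)) * indicator {0<..<v} x \<partial>lborel) *
        ennreal (1 / (1 - v) * ((ln (1 - v) - ln (1 - t)) ^ a / fact a)) * indicator {0<..<t} v =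
      tail_sum (inv_shift N) (\<lambda>n. ennreal (v ^ (n + N) / (1 - v)) * K v * indicator {0<..<t} v) m"
    proof (cases "0 < v \<and> v < t")
      case True
      then have e: "ennreal (v ^ (n + N) / (1 - v)) = ennreal (1 / (1 - v)) * ennreal (v ^ (n + N))" for n
        using assms by (subst ennreal_mult'[symmetric]) auto
      have inner: "(\<integral>\<^sup>+x. ennreal (x ^ (m + N) / (1 - x)) * indicator {0<..<v} x \<partial>lborel) =
          tail_sum (inv_shift N) (\<lambda>n. ennreal (v ^ (n + N))) m"
        by (rule nn_integral_power_geometric) (use True assms in auto)
      have "ennreal (1 / (1 - v) * ((ln (1 - v) - ln (1 - t)) ^ a / fact a)) = ennreal (1 / (1 - v)) * K v"
        unfolding K_def using True assms by (intro ennreal_mult') auto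
      moreover have "tail_sum (inv_shift N) (\<lambda>n. ennreal (v ^ (n + N) / (1 - v)) * K v) m =
          ennreal (1 / (1 - v)) * K v * tail_sum (inv_shift N) (\<lambda>n. ennreal (v ^ (n + N))) m"
        unfolding e tail_sum_cmult[symmetric] by (simp add: mult_ac)
      ultimately show ?thesis
        unfolding inner using True by (simp add: mult_ac)
    qed (auto simp: tail_sum_def)
  qed
  also have "\<dots> = tail_sum (inv_shift N)
      (\<lambda>n. \<integral>\<^sup>+v. ennreal (v ^ (n + N) / (1 - v)) * K v * indicator {0<..<t} v \<partial>lborel) m"
    by (rule nn_integral_tail_sum) (simp add: K_def)
  also have "\<dots> = (tail_sum (inv_shift N) ^^ Suc (Suc a)) (\<lambda>n. ennreal (t ^ (n + N))) m"
    unfolding K_def Suc by simp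
  finally show ?case .
qed

text \<open>The factor \<open>n\<^bsup>-k\<^esup> \<cdot> n / (n + N)\<close> that an entry \<open>n > 0\<close> of the tuple contributes, for \<open>k \<ge> 1\<close>, to
  the Laplace transform at \<open>N\<close>.\<close>

definition index_weight :: "nat \<Rightarrow> nat \<Rightarrow> nat \<Rightarrow> real" where
  "index_weight N k n = 1 / (real n ^ (k - 1) * real (n + N))"

lemma index_weight_1 [simp]: "index_weight N (Suc 0) = inv_shift N"
  by (simp add: index_weight_def fun_eq_iff)

text \<open>The factors of the simplex integrand, multiplied by \<open>exp (-N L)\<close>, that belong to one pair of
  variables \<open>(x, z)\<close>; the variable that follows the pair is \<open>y\<close>.\<close>

definition block_factor :: "nat \<Rightarrow> nat \<Rightarrow> nat \<Rightarrow> real \<Rightarrow> real \<Rightarrow> real \<Rightarrow> real" where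
  "block_factor N p q x z y =
    1 / ((1 - x) * z) * (ln ((1 - x) / (1 - z)) ^ p * ln (y / z) ^ q) * (x / z) ^ N"

lemma block_factor_measurable [measurable (raw)]:
  assumes [measurable]: "f \<in> borel_measurable M" "g \<in> borel_measurable M" "h \<in> borel_measurable M"
  shows "(\<lambda>x. block_factor N p q (f x) (g x) (h x)) \<in> borel_measurable M"
  unfolding block_factor_def by measurable

text \<open>Integrating out one pair of variables. The \<open>x\<close>-integral creates \<open>p + 1\<close> layers and the monomial
  \<open>z\<^bsup>n+N\<^esup>\<close>; the factor \<open>z\<^bsup>-N\<^esup>\<close> cancels the shift, so that the \<open>z\<close>-integral gives
  \<open>y\<^sup>n / n\<^bsup>q+1\<^esup>\<close>, and this power of \<open>n\<close> merges with the last layer.\<close>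

lemma nn_integral_block:
  assumes y: "0 < y" "y \<le> 1"
  shows "(\<integral>\<^sup>+z. \<integral>\<^sup>+x. ennreal (x ^ m * block_factor N p q x z y) *
      (if 0 < x \<and> x < z \<and> z < y then 1 else 0) \<partial>lborel \<partial>lborel) =
    ennreal (fact p * fact q) *
      (tail_sum (inv_shift N) ^^ p) (tail_sum (index_weight N (q + 2)) (\<lambda>n. ennreal (y ^ n))) m"
    (is "?lhs = ennreal (fact p * fact q) * ?rhs")
proof -
  let ?Q = "tail_sum (inv_shift N)"
  define L where "L = (\<lambda>z. ennreal ((ln y - ln z) ^ q / fact q))"
  have split: "ennreal (x ^ m * block_factor N p q x z y) =
     ennreal (fact p * fact q) * (ennreal (1 / z ^ Suc N) * L z *
       (ennreal (x ^ (m + N) / (1 - x)) * ennreal ((ln (1 - x) - ln (1 - z)) ^ p / fact p)))"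
    if "0 < x" "x < z" "z < y" for x z
  proof -
    have "x ^ m * block_factor N p q x z y = fact p * fact q * (1 / z ^ Suc N * ((ln y - ln z) ^ q / fact q) *
        (x ^ (m + N) / (1 - x) * ((ln (1 - x) - ln (1 - z)) ^ p / fact p)))"
      using that y unfolding block_factor_def
      by (subst (1 2) ln_div) (auto simp: power_divide power_add divide_simps)
    also have "ennreal \<dots> = ennreal (fact p * fact q) * (ennreal (1 / z ^ Suc N) * L z *
       (ennreal (x ^ (m + N) / (1 - x)) * ennreal ((ln (1 - x) - ln (1 - z)) ^ p / fact p)))"
    proof -
      have ennreal_mult5: "ennreal (F * (A * B * (C * D))) = ennreal F * (ennreal A * ennreal B * (ennreal C * ennreal D))"
        if "0 \<le> F" "0 \<le> A" "0 \<le> B" "0 \<le> C" "0 \<le> D" for A B C D F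
        using that by (simp add: ennreal_mult)
      show ?thesis unfolding L_def by (rule ennreal_mult5) (use that y in auto)
    qed
    finally show ?thesis .
  qed
  have "?lhs = (\<integral>\<^sup>+z. ennreal (fact p * fact q) *
      (?Q ^^ Suc p) (\<lambda>n. (ennreal (1 / z ^ Suc N) * L z * indicator {0<..<y} z) * ennreal (z ^ (n + N))) m \<partial>lborel)"
  proof (rule nn_integral_cong)
    fix z :: real
    show "(\<integral>\<^sup>+x. ennreal (x ^ m * block_factor N p q x z y) *
        (if 0 < x \<and> x < z \<and> z < y then 1 else 0) \<partial>lborel) =
      ennreal (fact p * fact q) * (?Q ^^ Suc p)
        (\<lambda>n. (ennreal (1 / z ^ Suc N) * L z * indicator {0<..<y} z) * ennreal (z ^ (n + N))) m"
    proof (cases "0 < z \<and> z < y")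
      case True
      have "(\<integral>\<^sup>+x. ennreal (x ^ m * block_factor N p q x z y) *
        (if 0 < x \<and> x < z \<and> z < y then 1 else 0) \<partial>lborel) =
        (\<integral>\<^sup>+x. ennreal (fact p * fact q) * (ennreal (1 / z ^ Suc N) * L z) *
       (ennreal (x ^ (m + N) / (1 - x)) * ennreal ((ln (1 - x) - ln (1 - z)) ^ p / fact p) * indicator {0<..<z} x) \<partial>lborel)"
        using True by (intro nn_integral_cong) (auto simp: split mult.assoc)
      also have "\<dots> = ennreal (fact p * fact q) * (ennreal (1 / z ^ Suc N) * L z) *
          (?Q ^^ Suc p) (\<lambda>n. ennreal (z ^ (n + N))) m"
      proof (subst nn_integral_cmult)
        have z: "0 < z" "z < 1" using True y by auto
        show "ennreal (fact p * fact q) * (ennreal (1 / z ^ Suc N) * L z) *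
            (\<integral>\<^sup>+x. ennreal (x ^ (m + N) / (1 - x)) * ennreal ((ln (1 - x) - ln (1 - z)) ^ p / fact p) *
              indicator {0<..<z} x \<partial>lborel) =
          ennreal (fact p * fact q) * (ennreal (1 / z ^ Suc N) * L z) *
            (?Q ^^ Suc p) (\<lambda>n. ennreal (z ^ (n + N))) m"
          unfolding nn_integral_geometric_log_kernel[OF z] ..
      qed measurable
      finally show ?thesis
        using True by (subst funpow_tail_sum_cmult) (simp del: funpow.simps power_Suc add: mult.assoc)
    next
      case False
      then have "(\<integral>\<^sup>+x. ennreal (x ^ m * block_factor N p q x z y) *
          (if 0 < x \<and> x < z \<and> z < y then 1 else 0) \<partial>lborel) = (\<integral>\<^sup>+(x::real). 0 \<partial>lborel)"
        by (intro nn_integral_cong) auto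
      then show ?thesis
        using False by (subst funpow_tail_sum_cmult) (auto simp del: funpow.simps)
    qed
  qed
  also have "\<dots> = ennreal (fact p * fact q) * (?Q ^^ Suc p)
      (\<lambda>n. \<integral>\<^sup>+z. (ennreal (1 / z ^ Suc N) * L z * indicator {0<..<y} z) * ennreal (z ^ (n + N)) \<partial>lborel) m"
    unfolding L_def
    by (subst nn_integral_cmult, measurable, subst nn_integral_funpow_tail_sum, measurable)
  also have "(?Q ^^ Suc p)
      (\<lambda>n. \<integral>\<^sup>+z. (ennreal (1 / z ^ Suc N) * L z * indicator {0<..<y} z) * ennreal (z ^ (n + N)) \<partial>lborel) =
      (?Q ^^ p) (tail_sum (index_weight N (q + 2)) (\<lambda>n. ennreal (y ^ n)))"
    unfolding funpow_Suc_right comp_def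
  proof (intro arg_cong[where f="?Q ^^ p"] ext tail_sum_cong)
    fix m' n :: nat assume "m' < n"
    then have n: "0 < n" by simp
    have "(\<integral>\<^sup>+z. (ennreal (1 / z ^ Suc N) * L z * indicator {0<..<y} z) * ennreal (z ^ (n + N)) \<partial>lborel) =
      (\<integral>\<^sup>+z. ennreal (z ^ (n - 1)) * L z * indicator {0<..<y} z \<partial>lborel)"
    proof (rule nn_integral_cong)
      fix z :: real
      have "1 / z ^ Suc N * z ^ (n + N) = z ^ (n - 1)" if "0 < z"
        using n that by (cases n) (auto simp: power_add)
      then have "ennreal (1 / z ^ Suc N) * ennreal (z ^ (n + N)) = ennreal (z ^ (n - 1))" if "0 < z"
        using that by (subst ennreal_mult'[symmetric]) auto
      then show "(ennreal (1 / z ^ Suc N) * L z * indicator {0<..<y} z) * ennreal (z ^ (n + N)) =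
          ennreal (z ^ (n - 1)) * L z * indicator {0<..<y} z"
        by (cases "0 < z") (auto simp: mult_ac split: split_indicator)
    qed
    also have "\<dots> = ennreal (y ^ n / real n ^ Suc q)"
      unfolding L_def using y n by (intro nn_integral_power_log_kernel)
    finally have inner: "(\<integral>\<^sup>+z. (ennreal (1 / z ^ Suc N) * L z * indicator {0<..<y} z) * ennreal (z ^ (n + N)) \<partial>lborel) =
        ennreal (y ^ n / real n ^ Suc q)" .
    have "ennreal (inv_shift N n) * ennreal (y ^ n / real n ^ Suc q) = ennreal (inv_shift N n * (y ^ n / real n ^ Suc q))"
      by (rule ennreal_mult'[symmetric]) simp
    also have "inv_shift N n * (y ^ n / real n ^ Suc q) = index_weight N (q + 2) n * y ^ n"
      by (simp add: index_weight_def mult_ac)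
    also have "ennreal \<dots> = ennreal (index_weight N (q + 2) n) * ennreal (y ^ n)"
      by (rule ennreal_mult') (simp add: index_weight_def)
    finally show "ennreal (inv_shift N n) *
        (\<integral>\<^sup>+z. (ennreal (1 / z ^ Suc N) * L z * indicator {0<..<y} z) * ennreal (z ^ (n + N)) \<partial>lborel) =
      ennreal (index_weight N (q + 2) n) * ennreal (y ^ n)"
      unfolding inner .
  qed
  finally show ?thesis .
qed

section \<open>Sums over increasing tuples\<close>

text \<open>The empty tuple counts as ending in \<open>0\<close>, so that the first entry of a tuple ranges over all
  \<open>n > 0\<close> by the same rule as the later ones.\<close>

definition last0 :: "nat list \<Rightarrow> nat" where
  "last0 ns = (if ns = [] then 0 else last ns)"

definition tuple_weight :: "nat \<Rightarrow> nat list \<Rightarrow> nat list \<Rightarrow> real" where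
  "tuple_weight N ks ns = (\<Prod>j<length ks. index_weight N (ks ! j) (ns ! j))"

definition tuple_sum :: "nat \<Rightarrow> nat list \<Rightarrow> (nat \<Rightarrow> ennreal) \<Rightarrow> ennreal" where
  "tuple_sum N ks g = (\<integral>\<^sup>+ns. ennreal (tuple_weight N ks ns) * g (last0 ns) \<partial>count_space (increasing_tuples (length ks)))"

lemma index_weight_nonneg [simp]: "0 \<le> index_weight N k n"
  by (simp add: index_weight_def)

lemma tuple_weight_nonneg [simp]: "0 \<le> tuple_weight N ks ns"
  by (simp add: tuple_weight_def prod_nonneg)

lemma increasing_tuples_0 [simp]: "increasing_tuples 0 = {[]}"
  by (auto simp: increasing_tuples_def)

lemma tuple_sum_Nil: "tuple_sum N [] g = g 0"
  by (simp add: tuple_sum_def tuple_weight_def last0_def nn_integral_count_space_finite)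

text \<open>A tuple is extended by choosing the gap above its last entry, which makes the last layer of a tuple
  sum a tail sum.\<close>

lemma bij_betw_increasing_tuples_Suc:
  "bij_betw (\<lambda>(ns, k). ns @ [Suc (last0 ns + k)]) (increasing_tuples r \<times> UNIV) (increasing_tuples (Suc r))"
proof (rule bij_betw_imageI)
  show "inj_on (\<lambda>(ns, k). ns @ [Suc (last0 ns + k)]) (increasing_tuples r \<times> UNIV)"
    by (auto simp: inj_on_def)
  show "(\<lambda>(ns, k). ns @ [Suc (last0 ns + k)]) ` (increasing_tuples r \<times> UNIV) = increasing_tuples (Suc r)"
  proof (intro equalityI subsetI)
    fix ms assume "ms \<in> (\<lambda>(ns, k). ns @ [Suc (last0 ns + k)]) ` (increasing_tuples r \<times> UNIV)"
    then obtain ns k where ns: "ns \<in> increasing_tuples r" and ms: "ms = ns @ [Suc (last0 ns + k)]" by auto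
    have "n \<le> last0 ns" if n: "n \<in> set ns" for n
    proof -
      obtain j where j: "j < length ns" "n = ns ! j" using n by (auto simp: in_set_conv_nth)
      have "ns ! j \<le> ns ! (length ns - 1)"
        using ns j(1) by (cases "j = length ns - 1") (auto simp: increasing_tuples_def sorted_wrt_iff_nth_less intro: less_imp_le)
      then show ?thesis using j n by (auto simp: last0_def last_conv_nth)
    qed
    then show "ms \<in> increasing_tuples (Suc r)"
      using ns by (force simp: increasing_tuples_def ms sorted_wrt_append)
  next
    fix ms assume ms: "ms \<in> increasing_tuples (Suc r)"
    then have "ms \<noteq> []" by (auto simp: increasing_tuples_def)
    then obtain ns n where e: "ms = ns @ [n]" by (metis append_butlast_last_id)
    have ns: "ns \<in> increasing_tuples r" and n: "0 < n" "\<forall>x\<in>set ns. x < n"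
      using ms by (auto simp: increasing_tuples_def e sorted_wrt_append)
    then have "last0 ns < n" by (auto simp: last0_def)
    then have "n = Suc (last0 ns + (n - Suc (last0 ns)))" by simp
    then have "ms = (\<lambda>(ns, k). ns @ [Suc (last0 ns + k)]) (ns, n - Suc (last0 ns))" by (simp add: e)
    then show "ms \<in> (\<lambda>(ns, k). ns @ [Suc (last0 ns + k)]) ` (increasing_tuples r \<times> UNIV)"
      using ns by blast
  qed
qed

lemma countable_increasing_tuples [simp]: "countable (increasing_tuples r)"
  by (rule countableI_type)

lemma tuple_weight_snoc:
  "ns \<in> increasing_tuples (length ks) \<Longrightarrow> tuple_weight N (ks @ [k]) (ns @ [n]) = tuple_weight N ks ns * index_weight N k n"
  by (simp add: tuple_weight_def increasing_tuples_def nth_append)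

lemma tuple_sum_snoc:
  "tuple_sum N (ks @ [k]) g = tuple_sum N ks (tail_sum (index_weight N k) g)"
proof -
  let ?I = "increasing_tuples (length ks)"
  let ?f = "\<lambda>(ns, j). ennreal (tuple_weight N ks ns) * (ennreal (index_weight N k (Suc (last0 ns + j))) * g (Suc (last0 ns + j)))"
  have "tuple_sum N (ks @ [k]) g =
    (\<integral>\<^sup>+x. ennreal (tuple_weight N (ks @ [k]) ((\<lambda>(ns, k). ns @ [Suc (last0 ns + k)]) x)) *
       g (last0 ((\<lambda>(ns, k). ns @ [Suc (last0 ns + k)]) x)) \<partial>count_space (?I \<times> UNIV))"
  proof -
    have len: "length (ks @ [k]) = Suc (length ks)" by simp
    show ?thesis
      unfolding tuple_sum_def len
      by (rule nn_integral_bij_count_space[OF bij_betw_increasing_tuples_Suc, symmetric,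
            where f="\<lambda>ns. ennreal (tuple_weight N (ks @ [k]) ns) * g (last0 ns)"])
  qed
  also have "\<dots> = (\<integral>\<^sup>+x. ?f x \<partial>count_space (?I \<times> UNIV))"
    by (intro nn_integral_cong) (auto simp: tuple_weight_snoc last0_def ennreal_mult mult.assoc)
  also have "count_space (?I \<times> (UNIV :: nat set)) = count_space ?I \<Otimes>\<^sub>M count_space UNIV"
    by (rule pair_measure_countable[symmetric]) auto
  also have "(\<integral>\<^sup>+x. ?f x \<partial>(count_space ?I \<Otimes>\<^sub>M count_space UNIV)) =
      (\<integral>\<^sup>+ns. \<integral>\<^sup>+j. ?f (ns, j) \<partial>count_space UNIV \<partial>count_space ?I)"
    by (rule sigma_finite_measure.nn_integral_fst[symmetric])
       (auto simp: sigma_finite_measure_count_space pair_measure_countable)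
  also have "\<dots> = tuple_sum N ks (tail_sum (index_weight N k) g)"
    unfolding tuple_sum_def tail_sum_def
    by (intro nn_integral_cong) (simp add: nn_integral_count_space_nat ennreal_suminf_cmult)
  finally show ?thesis .
qed

lemma tuple_sum_append_ones:
  "tuple_sum N (ks @ replicate p 1) g = tuple_sum N ks ((tail_sum (inv_shift N) ^^ p) g)"
proof (induction p arbitrary: g)
  case (Suc p)
  have "tuple_sum N (ks @ replicate (Suc p) 1) g = tuple_sum N ((ks @ replicate p 1) @ [1]) g"
    by (simp add: replicate_append_same)
  then show ?case
    by (simp only: tuple_sum_snoc Suc index_weight_1[folded One_nat_def] funpow_Suc_right comp_def)
qed simp

lemma tuple_sum_block:
  "tuple_sum N (ks @ replicate p 1 @ [q + 2]) g =
   tuple_sum N ks ((tail_sum (inv_shift N) ^^ p) (tail_sum (index_weight N (q + 2)) g))"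
  using tuple_sum_snoc[of N "ks @ replicate p 1"] by (simp only: append_assoc tuple_sum_append_ones)

lemma tuple_sum_nn_integral:
  assumes [measurable]: "\<And>n. (\<lambda>x. g x n) \<in> borel_measurable M"
  shows "(\<integral>\<^sup>+x. tuple_sum N ks (g x) \<partial>M) = tuple_sum N ks (\<lambda>n. \<integral>\<^sup>+x. g x n \<partial>M)"
  unfolding tuple_sum_def by (subst nn_integral_count_space_nn_integral) (simp_all add: nn_integral_cmult)

lemma tuple_sum_cmult: "tuple_sum N ks (\<lambda>n. x * g n) = x * tuple_sum N ks g"
  unfolding tuple_sum_def by (subst nn_integral_cmult[symmetric]) (simp_all add: mult_ac)

section \<open>The Laplace transform on the simplex\<close>

text \<open>The simplex below a free upper endpoint \<open>y\<close>, stored in the coordinate \<open>2 d + 1\<close>. The endpoint is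
  needed for the induction on \<open>d\<close>: for \<open>d + 1\<close> pairs, the inner \<open>2 d\<close> variables lie below the next
  variable instead of below \<open>1\<close>.\<close>

definition chain :: "nat \<Rightarrow> real \<Rightarrow> (nat \<Rightarrow> real) \<Rightarrow> bool" where
  "chain d y t \<longleftrightarrow> 0 < (t(2 * d + 1 := y)) 1 \<and> (\<forall>j\<in>{1..2 * d}. (t(2 * d + 1 := y)) j < (t(2 * d + 1 := y)) (j + 1))"

definition simplex_density :: "nat \<Rightarrow> (nat \<Rightarrow> nat) \<Rightarrow> (nat \<Rightarrow> nat) \<Rightarrow> nat \<Rightarrow> real \<Rightarrow> (nat \<Rightarrow> real) \<Rightarrow> real" where
  "simplex_density d a b N y t = (let u = t(2 * d + 1 := y) in
     \<Prod>l=1..d. block_factor N (a l - 1) (b l - 1) (u (2 * l - 1)) (u (2 * l)) (u (2 * l + 1)))"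

lemma measurable_coord [measurable (raw)]:
  assumes "j \<in> {1..m + 1}"
  shows "(\<lambda>t. (t(m + 1 := y)) j) \<in> borel_measurable (lebesgue_power m)"
proof (cases "j = m + 1")
  case False
  then have "(\<lambda>t. t j) \<in> borel_measurable (lebesgue_power m)"
    using assms measurable_component_singleton[of j "{1..m}" "\<lambda>_. lborel :: real measure"]
    by (simp add: lebesgue_power_def)
  then show ?thesis using False by simp
qed simp

lemma chain_measurable [measurable]: "Measurable.pred (lebesgue_power (2 * d)) (chain d y)"
  unfolding chain_def
  by (intro pred_intros_logic pred_intros_finite borel_measurable_pred_less measurable_coord) auto

lemma simplex_density_measurable [measurable]:
  "simplex_density d a b N y \<in> borel_measurable (lebesgue_power (2 * d))"
  unfolding simplex_density_def Let_def
  by (intro borel_measurable_prod block_factor_measurable measurable_coord) auto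

lemma chain_Suc:
  "chain (Suc d) y (t(2 * d + 1 := x, 2 * d + 2 := z)) \<longleftrightarrow> chain d x t \<and> x < z \<and> z < y"
proof -
  define v where "v = (t(2 * d + 1 := x, 2 * d + 2 := z))(2 * Suc d + 1 := y)"
  have v: "v j = (t(2 * d + 1 := x)) j" if "j \<le> 2 * d + 1" for j using that by (auto simp: v_def)
  have v': "v (2 * d + 1) = x" "v (2 * d + 2) = z" "v (2 * d + 3) = y" by (auto simp: v_def)
  have e: "{1..2 * Suc d} = insert (2 * d + 2) (insert (2 * d + 1) {1..2 * d})" by auto
  have "chain (Suc d) y (t(2 * d + 1 := x, 2 * d + 2 := z)) \<longleftrightarrow>
      0 < v 1 \<and> z < y \<and> x < z \<and> (\<forall>j\<in>{1..2 * d}. v j < v (j + 1))"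
    unfolding chain_def v_def[symmetric] e using v' by (simp add: eval_nat_numeral)
  also have "\<dots> \<longleftrightarrow> chain d x t \<and> x < z \<and> z < y"
    unfolding chain_def using v by auto
  finally show ?thesis .
qed

lemma simplex_density_Suc:
  "simplex_density (Suc d) a b N y (t(2 * d + 1 := x, 2 * d + 2 := z)) =
   simplex_density d a b N x t * block_factor N (a (Suc d) - 1) (b (Suc d) - 1) x z y"
proof -
  define v where "v = (t(2 * d + 1 := x, 2 * d + 2 := z))(2 * Suc d + 1 := y)"
  have v: "v j = (t(2 * d + 1 := x)) j" if "j \<le> 2 * d + 1" for j using that by (auto simp: v_def)
  have v': "v (2 * d + 1) = x" "v (2 * d + 2) = z" "v (2 * d + 3) = y" by (auto simp: v_def)
  have "(\<Prod>l=1..d. block_factor N (a l - 1) (b l - 1) (v (2 * l - 1)) (v (2 * l)) (v (2 * l + 1))) =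
      simplex_density d a b N x t"
    unfolding simplex_density_def Let_def
  proof (intro prod.cong refl)
    fix l assume "l \<in> {1..d}"
    then have "2 * l - 1 \<le> 2 * d + 1" "2 * l \<le> 2 * d + 1" "2 * l + 1 \<le> 2 * d + 1" by auto
    then show "block_factor N (a l - 1) (b l - 1) (v (2 * l - 1)) (v (2 * l)) (v (2 * l + 1)) =
      block_factor N (a l - 1) (b l - 1) ((t(2 * d + 1 := x)) (2 * l - 1)) ((t(2 * d + 1 := x)) (2 * l))
        ((t(2 * d + 1 := x)) (2 * l + 1))"
      by (simp only: v)
  qed
  then show ?thesis
    unfolding simplex_density_def Let_def v_def[symmetric] using v'
    by (simp add: eval_nat_numeral)
qed

lemma chain_pos:
  assumes "chain d y t" "j \<le> 2 * d"
  shows "0 < (t(2 * d + 1 := y)) (Suc j)"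
proof -
  define u where "u = t(2 * d + 1 := y)"
  have u1: "0 < u 1" and step: "\<And>j. j \<in> {1..2 * d} \<Longrightarrow> u j < u (j + 1)"
    using assms(1) unfolding chain_def u_def[symmetric] by blast+
  have "j \<le> 2 * d \<longrightarrow> 0 < u (Suc j)"
  proof (induction j)
    case 0 then show ?case using u1 by simp
  next
    case (Suc j) then show ?case using step[of "Suc j"] by auto
  qed
  then show ?thesis using assms(2) by (simp add: u_def)
qed

lemma chain_last_pos: "chain d y t \<Longrightarrow> 0 < y"
  using chain_pos[of d y t "2 * d"] by simp

lemma block_index_Suc:
  assumes "b (Suc d) \<ge> 1"
  shows "block_index (Suc d) a b = block_index d a b @ replicate (a (Suc d) - 1) 1 @ [(b (Suc d) - 1) + 2]"
  using assms by (simp add: block_index_def)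

lemma block_factor_nonneg:
  assumes "0 < x" "x < z" "z < y" "y \<le> 1"
  shows "0 \<le> block_factor N p q x z y"
  unfolding block_factor_def using assms
  by (intro mult_nonneg_nonneg zero_le_power divide_nonneg_nonneg ln_ge_zero) (auto simp: field_simps)

lemma simplex_density_nonneg:
  assumes "chain d y t" "y \<le> 1"
  shows "0 \<le> simplex_density d a b N y t"
proof -
  define u where "u = t(2 * d + 1 := y)"
  have less: "u j < u (j + 1)" if "1 \<le> j" "j \<le> 2 * d" for j using that assms by (auto simp: chain_def u_def)
  have pos: "0 < u (Suc j)" if "j \<le> 2 * d" for j
    unfolding u_def by (rule chain_pos[OF assms(1) that])
  have le1: "u (2 * d + 1 - j) \<le> 1" if "j \<le> 2 * d" for j using that
  proof (induction j)
    case 0 then show ?case using assms by (simp add: u_def)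
  next
    case (Suc j)
    have "1 \<le> 2 * d + 1 - Suc j" using Suc.prems by arith
    from less[OF this] Suc show ?case by (simp add: Suc_diff_le)
  qed
  have "0 \<le> block_factor N (a l - 1) (b l - 1) (u (2 * l - 1)) (u (2 * l)) (u (2 * l + 1))" if "l \<in> {1..d}" for l
  proof (rule block_factor_nonneg)
    show "0 < u (2 * l - 1)" using pos[of "2 * l - 2"] that by (auto simp: Suc_diff_Suc numeral_2_eq_2)
    show "u (2 * l - 1) < u (2 * l)" using less[of "2 * l - 1"] that by auto
    show "u (2 * l) < u (2 * l + 1)" using less[of "2 * l"] that by auto
    show "u (2 * l + 1) \<le> 1" using le1[of "2 * d - 2 * l"] that by (auto simp: Suc_diff_le)
  qed
  then show ?thesis unfolding simplex_density_def Let_def u_def[symmetric] by (auto intro: prod_nonneg)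
qed

text \<open>Induction on the number of pairs. The inner integral is, by induction, a power series in the
  endpoint \<open>x\<close> with nonnegative coefficients; integrating the last pair against the monomial \<open>x\<^sup>n\<close>
  appends one block to the index.\<close>

lemma nn_integral_simplex_density:
  assumes "0 < y" "y \<le> 1" and b: "\<And>l. l \<in> {1..d} \<Longrightarrow> b l \<ge> 1"
  shows "(\<integral>\<^sup>+t. ennreal (simplex_density d a b N y t) * (if chain d y t then 1 else 0) \<partial>lebesgue_power (2 * d)) =
    ennreal (\<Prod>l=1..d. fact (a l - 1) * fact (b l - 1)) * tuple_sum N (block_index d a b) (\<lambda>n. ennreal (y ^ n))"
  using assms
proof (induction d arbitrary: y)
  case 0
  then show ?case
    by (simp add: lebesgue_power_def simplex_density_def block_index_def tuple_sum_Nil chain_def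
        nn_integral_count_space_finite PiM_empty)
next
  case (Suc d)
  define p where "p = a (Suc d) - 1"
  define q where "q = b (Suc d) - 1"
  define C where "C = ennreal (\<Prod>l=1..d. fact (a l - 1) * fact (b l - 1))"
  define \<Phi> where "\<Phi> = (\<lambda>t. ennreal (simplex_density (Suc d) a b N y t) * (if chain (Suc d) y t then 1 else 0))"
  interpret P: product_sigma_finite "\<lambda>_::nat. lborel :: real measure" ..
  have e: "{1..2 * Suc d} = insert (2 * d + 2) (insert (2 * d + 1) {1..2 * d})" by auto
  have meas: "\<Phi> \<in> borel_measurable (lebesgue_power (2 * Suc d))"
    unfolding \<Phi>_def by measurable
  have inner: "(\<lambda>t. \<Phi> (t(2 * d + 2 := z))) \<in> borel_measurable (PiM (insert (2 * d + 1) {1..2 * d}) (\<lambda>_. lborel))" for z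
  proof -
    have "(\<lambda>t. t(2 * d + 2 := z)) \<in> PiM (insert (2 * d + 1) {1..2 * d}) (\<lambda>_. lborel) \<rightarrow>\<^sub>M lebesgue_power (2 * Suc d)"
      unfolding lebesgue_power_def e by (rule measurable_fun_upd[where J="insert (2 * d + 1) {1..2 * d}"]) auto
    from measurable_comp[OF this meas] show ?thesis by (simp add: comp_def)
  qed
  have "(\<integral>\<^sup>+t. \<Phi> t \<partial>lebesgue_power (2 * Suc d)) =
    (\<integral>\<^sup>+z. \<integral>\<^sup>+t. \<Phi> (t(2 * d + 2 := z)) \<partial>PiM (insert (2 * d + 1) {1..2 * d}) (\<lambda>_. lborel) \<partial>lborel)"
    unfolding lebesgue_power_def e
    by (rule P.product_nn_integral_insert_rev[OF _ _ meas[unfolded lebesgue_power_def e]]) auto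
  also have "\<dots> = (\<integral>\<^sup>+z. \<integral>\<^sup>+x. \<integral>\<^sup>+t. \<Phi> (t(2 * d + 1 := x, 2 * d + 2 := z)) \<partial>lebesgue_power (2 * d) \<partial>lborel \<partial>lborel)"
    unfolding lebesgue_power_def
    by (intro nn_integral_cong P.product_nn_integral_insert_rev[OF _ _ inner]) auto
  also have "\<dots> = (\<integral>\<^sup>+z. \<integral>\<^sup>+x. C * tuple_sum N (block_index d a b)
      (\<lambda>n. ennreal (x ^ n * block_factor N p q x z y) * (if 0 < x \<and> x < z \<and> z < y then 1 else 0)) \<partial>lborel \<partial>lborel)"
  proof (intro nn_integral_cong)
    fix z x :: real
    show "(\<integral>\<^sup>+t. \<Phi> (t(2 * d + 1 := x, 2 * d + 2 := z)) \<partial>lebesgue_power (2 * d)) =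
      C * tuple_sum N (block_index d a b)
      (\<lambda>n. ennreal (x ^ n * block_factor N p q x z y) * (if 0 < x \<and> x < z \<and> z < y then 1 else 0))"
    proof (cases "0 < x \<and> x < z \<and> z < y")
      case True
      then have x: "0 < x" "x \<le> 1" and f: "0 \<le> block_factor N p q x z y"
        using Suc.prems by (auto intro!: block_factor_nonneg)
      have "(\<integral>\<^sup>+t. \<Phi> (t(2 * d + 1 := x, 2 * d + 2 := z)) \<partial>lebesgue_power (2 * d)) =
        (\<integral>\<^sup>+t. ennreal (block_factor N p q x z y) *
          (ennreal (simplex_density d a b N x t) * (if chain d x t then 1 else 0)) \<partial>lebesgue_power (2 * d))"
        unfolding \<Phi>_def chain_Suc simplex_density_Suc p_def[symmetric] q_def[symmetric]
        using True f by (intro nn_integral_cong) (auto simp: ennreal_mult'[OF f] mult_ac)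
      also have "\<dots> = ennreal (block_factor N p q x z y) *
          (C * tuple_sum N (block_index d a b) (\<lambda>n. ennreal (x ^ n)))"
        unfolding C_def using Suc.IH[OF x] Suc.prems(3)
        by (subst nn_integral_cmult) auto
      also have "\<dots> = C * tuple_sum N (block_index d a b)
          (\<lambda>n. ennreal (block_factor N p q x z y) * ennreal (x ^ n))"
        unfolding tuple_sum_cmult by (simp only: mult_ac)
      finally show ?thesis using True x f by (simp add: ennreal_mult mult_ac)
    next
      case False
      then have "\<Phi> (t(2 * d + 1 := x, 2 * d + 2 := z)) = 0" for t
        unfolding \<Phi>_def chain_Suc using chain_last_pos[of d x t] by auto
      then show ?thesis unfolding if_not_P[OF False] by (simp add: tuple_sum_def)
    qed
  qed
  also have "\<dots> = C * tuple_sum N (block_index d a b) (\<lambda>n. \<integral>\<^sup>+z. \<integral>\<^sup>+x.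
      ennreal (x ^ n * block_factor N p q x z y) * (if 0 < x \<and> x < z \<and> z < y then 1 else 0) \<partial>lborel \<partial>lborel)"
    unfolding tuple_sum_cmult[symmetric]
    by (simp add: tuple_sum_nn_integral nn_integral_cmult lborel.borel_measurable_nn_integral)
  also have "\<dots> = C * tuple_sum N (block_index d a b) (\<lambda>n. ennreal (fact p * fact q) *
      (tail_sum (inv_shift N) ^^ p) (tail_sum (index_weight N (q + 2)) (\<lambda>n. ennreal (y ^ n))) n)"
    by (simp only: nn_integral_block[OF Suc.prems(1,2)])
  also have "\<dots> = C * ennreal (fact p * fact q) * tuple_sum N (block_index (Suc d) a b) (\<lambda>n. ennreal (y ^ n))"
  proof -
    have bi: "block_index (Suc d) a b = block_index d a b @ replicate p 1 @ [q + 2]"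
      unfolding p_def q_def using Suc.prems(3) by (intro block_index_Suc) auto
    show ?thesis unfolding bi tuple_sum_block tuple_sum_cmult by (simp only: mult.assoc)
  qed
  also have "C * ennreal (fact p * fact q) = ennreal (\<Prod>l=1..Suc d. fact (a l - 1) * fact (b l - 1))"
    by (simp add: C_def p_def q_def ennreal_mult prod_nonneg)
  finally show ?case unfolding \<Phi>_def .
qed

section \<open>The Ohno function as a moment of a mixture\<close>

text \<open>The principal logarithm is discontinuous on the negative axis; along the real line the power is
  given by explicit formulas on either side of \<open>0\<close>.\<close>

lemma of_real_powr_measurable [measurable (raw)]:
  assumes [measurable]: "f \<in> borel_measurable M"
  shows "(\<lambda>x. complex_of_real (f x) powr s) \<in> borel_measurable M"
proof -
  have "(\<lambda>x. complex_of_real x powr s) =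
      (\<lambda>x. if x = 0 then 0 else exp (s * (complex_of_real (ln \<bar>x\<bar>) + complex_of_real (if x < 0 then pi else 0) * \<i>)))"
    by (simp add: fun_eq_iff powr_def Ln_of_real')
  moreover have "\<dots> \<in> borel_measurable borel" by measurable
  ultimately have "(\<lambda>x. complex_of_real x powr s) \<in> borel_measurable borel" by simp
  from measurable_compose[OF assms this] show ?thesis .
qed

text \<open>The Gamma integral after the substitution \<open>u \<mapsto> c u\<close>.\<close>

lemma has_bochner_integral_Gamma:
  assumes s: "- 1 < Re s" and c: "0 < c"
  shows "has_bochner_integral lborel
    (\<lambda>u. indicator {0<..} u *\<^sub>R (complex_of_real u powr s * of_real (exp (- (c * u)))))
    (Gamma (s + 1) / of_real c powr (s + 1))"
proof -
  define f where "f = (\<lambda>u. indicator {0<..} u *\<^sub>R (complex_of_real u powr s * of_real (exp (- u))))"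
  have f_eq: "f = (\<lambda>u. indicator {0<..} u *\<^sub>R (complex_of_real u powr (s + 1 - 1) / of_real (exp u)))"
    by (simp add: f_def fun_eq_iff exp_minus divide_inverse)
  have [measurable]: "f \<in> borel_measurable borel" unfolding f_def by measurable
  have "(\<lambda>u. complex_of_real u powr (s + 1 - 1) / of_real (exp u)) absolutely_integrable_on {0<..}"
    by (rule absolutely_integrable_Gamma_integral') (use s in simp)
  then have "integrable lebesgue f"
    by (simp add: f_eq set_integrable_def)
  then have int: "integrable lborel f" by (simp add: integrable_completion)
  have "((\<lambda>u. complex_of_real u powr (s + 1 - 1) / of_real (exp u)) has_integral Gamma (s + 1)) {0<..}"
    by (rule Gamma_integral_complex') (use s in simp)
  then have "(f has_integral Gamma (s + 1)) UNIV"
  proof -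
    have "f = (\<lambda>u. if u \<in> {0<..} then complex_of_real u powr (s + 1 - 1) / of_real (exp u) else 0)"
      by (auto simp: f_eq fun_eq_iff indicator_def)
    then show ?thesis
      using \<open>(_ has_integral Gamma (s + 1)) {0<..}\<close> by (simp only: has_integral_restrict_UNIV)
  qed
  then have "integral\<^sup>L lborel f = Gamma (s + 1)"
    using has_integral_unique has_integral_integral_lborel[OF int] by blast
  with int have "has_bochner_integral lborel f (Gamma (s + 1))"
    by (simp add: has_bochner_integral_iff)
  then have "has_bochner_integral lborel (\<lambda>u. f (0 + c * u)) (Gamma (s + 1) /\<^sub>R \<bar>c\<bar>)"
    using c by (subst (asm) lborel_has_bochner_integral_real_affine_iff[where c=c and t=0]) auto
  then have "has_bochner_integral lborel (\<lambda>u. f (c * u) * (1 / of_real c powr s)) (Gamma (s + 1) /\<^sub>R c * (1 / of_real c powr s))"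
    using c by (intro has_bochner_integral_mult_left) auto
  moreover have "f (c * u) * (1 / of_real c powr s) =
      indicator {0<..} u *\<^sub>R (complex_of_real u powr s * of_real (exp (- (c * u))))" for u
  proof (cases "0 < u")
    case True
    then have "complex_of_real (c * u) powr s = of_real c powr s * of_real u powr s"
      using c by (simp add: powr_times_real)
    then show ?thesis using True c by (simp add: f_def)
  qed (use c in \<open>auto simp: f_def zero_less_mult_iff\<close>)
  moreover have "Gamma (s + 1) /\<^sub>R c * (1 / of_real c powr s) = Gamma (s + 1) / of_real c powr (s + 1)"
    using c by (simp add: powr_add scaleR_conv_of_real field_simps)
  ultimately show ?thesis by simp
qed

lemma has_bochner_integral_exp:
  fixes c :: real
  assumes "0 < c"
  shows "has_bochner_integral lborel (\<lambda>u. indicator {0<..} u * exp (- (c * u))) (1 / c)"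
proof -
  let ?g = "\<lambda>u::real. indicator {0<..} u * exp (- (c * u))"
  have eq: "indicator {0<..} u *\<^sub>R (complex_of_real u powr 0 * of_real (exp (- (c * u)))) = of_real (?g u)" for u
    by (simp split: split_indicator)
  have "has_bochner_integral lborel (\<lambda>u. complex_of_real (?g u)) (of_real (1 / c))"
    using has_bochner_integral_Gamma[of 0 c] assms unfolding eq by simp
  then have "complex_integrable lborel (\<lambda>u. complex_of_real (?g u))" "(\<integral>u. complex_of_real (?g u) \<partial>lborel) = of_real (1 / c)"
    by (simp_all add: has_bochner_integral_iff)
  then show ?thesis
    unfolding complex_of_real_integrable_eq integral_complex_of_real of_real_eq_iff
    by (simp add: has_bochner_integral_iff)
qed

lemma nn_integral_hypoexp_laplace:
  assumes A: "finite A" "A \<noteq> {}" "\<And>x. x \<in> A \<Longrightarrow> 0 < x" and "0 \<le> z"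
  shows "(\<integral>\<^sup>+u. ennreal (indicator {0<..} u * hypoexp_density A u * exp (- (z * u))) \<partial>lborel) =
    ennreal (\<Prod>x\<in>A. x / (x + z))"
proof -
  have "has_bochner_integral lborel (\<lambda>u. \<Sum>x\<in>A. (lagrange_weight A x * x) * (indicator {0<..} u * exp (- ((x + z) * u))))
    (\<Sum>x\<in>A. (lagrange_weight A x * x) * (1 / (x + z)))"
    using A assms(4) by (intro has_bochner_integral_sum has_bochner_integral_mult_right has_bochner_integral_exp) (auto simp: add_pos_nonneg)
  also have "(\<Sum>x\<in>A. (lagrange_weight A x * x) * (1 / (x + z))) = (\<Prod>x\<in>A. x / (x + z))"
  proof -
    have "x + z \<noteq> 0" if "x \<in> A" for x using A(3)[OF that] assms(4) by simp
    from partial_fractions[OF A(1,2) this] show ?thesis by simp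
  qed
  also have "(\<lambda>u. \<Sum>x\<in>A. (lagrange_weight A x * x) * (indicator {0<..} u * exp (- ((x + z) * u)))) =
      (\<lambda>u. indicator {0<..} u * hypoexp_density A u * exp (- (z * u)))"
  proof -
    have "exp (- ((x + z) * u)) = exp (- (x * u)) * exp (- (z * u))" for x u
      by (simp add: exp_add[symmetric] algebra_simps)
    then show ?thesis
      by (auto simp: fun_eq_iff hypoexp_density_def sum_distrib_left mult_ac intro!: sum.cong split: split_indicator)
  qed
  finally have "has_bochner_integral lborel (\<lambda>u. indicator {0<..} u * hypoexp_density A u * exp (- (z * u))) (\<Prod>x\<in>A. x / (x + z))" .
  then show ?thesis
    using A by (subst nn_integral_eq_integral)
      (auto simp: has_bochner_integral_iff hypoexp_density_nonneg split: split_indicator)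
qed

definition value_set :: "nat list \<Rightarrow> real set" where
  "value_set ns = real ` set ns"

lemma value_set_image:
  assumes "ns \<in> increasing_tuples r"
  shows "value_set ns = (\<lambda>j. real (ns ! j)) ` {..<r}" "inj_on (\<lambda>j. real (ns ! j)) {..<r}"
  using increasing_tuplesD(1)[OF assms] increasing_tuples_nth_eq_iff[OF assms]
  by (auto simp: value_set_def set_conv_nth inj_on_def)

lemma value_set_props:
  assumes "ns \<in> increasing_tuples r" "0 < r"
  shows "finite (value_set ns)" "value_set ns \<noteq> {}" "\<And>x. x \<in> value_set ns \<Longrightarrow> 0 < x"
  using assms by (auto simp: value_set_def increasing_tuples_def)

lemma lagrange_weight_value_set:
  assumes "ns \<in> increasing_tuples r" "i < r"
  shows "lagrange_weight (value_set ns) (real (ns ! i)) =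
    (\<Prod>j\<in>{..<r} - {i}. real (ns ! j) / (real (ns ! j) - real (ns ! i)))"
proof -
  note vs = value_set_image[OF assms(1)]
  have "value_set ns - {real (ns ! i)} = (\<lambda>j. real (ns ! j)) ` ({..<r} - {i})"
    using assms(2) increasing_tuples_nth_eq_iff[OF assms(1)] unfolding vs(1) by auto
  moreover have "inj_on (\<lambda>j. real (ns ! j)) ({..<r} - {i})" using vs(2) by (rule inj_on_subset) auto
  ultimately show ?thesis by (simp add: lagrange_weight_def prod.reindex)
qed

definition zeta_weight :: "nat list \<Rightarrow> nat list \<Rightarrow> real" where
  "zeta_weight ks ns = 1 / (\<Prod>j<length ks. real (ns ! j) ^ (ks ! j))"

lemma zeta_weight_nonneg [simp]: "0 \<le> zeta_weight ks ns"
  by (simp add: zeta_weight_def prod_nonneg)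

lemma Ohno_term_eq_lagrange:
  assumes "ns \<in> increasing_tuples (length ks)" "i < length ks"
  shows "Ohno_term ks s i ns =
    of_real (zeta_weight ks ns * lagrange_weight (value_set ns) (real (ns ! i))) / of_nat (ns ! i) powr s"
  unfolding Ohno_term_def zeta_weight_def lagrange_weight_value_set[OF assms] by simp

lemma tuple_weight_eq:
  assumes ks: "\<And>j. j < length ks \<Longrightarrow> 1 \<le> ks ! j" and ns: "ns \<in> increasing_tuples (length ks)"
  shows "tuple_weight N ks ns = zeta_weight ks ns * (\<Prod>x\<in>value_set ns. x / (x + real N))"
proof -
  have "tuple_weight N ks ns = (\<Prod>j<length ks. 1 / real (ns ! j) ^ (ks ! j) * (real (ns ! j) / (real (ns ! j) + real N)))"
    unfolding tuple_weight_def
  proof (intro prod.cong refl)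
    fix j assume "j \<in> {..<length ks}"
    then have "1 \<le> ks ! j" "0 < ns ! j" using ks[of j] increasing_tuplesD(2)[OF ns] by auto
    moreover from this obtain k where "ks ! j = Suc k" by (cases "ks ! j") auto
    ultimately show "index_weight N (ks ! j) (ns ! j) = 1 / real (ns ! j) ^ (ks ! j) * (real (ns ! j) / (real (ns ! j) + real N))"
      by (simp add: index_weight_def)
  qed
  then show ?thesis
    by (simp add: zeta_weight_def value_set_image[OF ns] prod.reindex prod.distrib prod_dividef)
qed

lemma has_bochner_integral_hypoexp_powr:
  assumes ns: "ns \<in> increasing_tuples (length ks)" and s: "- 1 < Re s"
  shows "has_bochner_integral lborel
    (\<lambda>u. (indicator {0<..} u * (zeta_weight ks ns * hypoexp_density (value_set ns) u)) *\<^sub>R (complex_of_real u powr s))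
    (Gamma (s + 1) * (\<Sum>i<length ks. Ohno_term ks s i ns))"
proof -
  let ?x = "\<lambda>i. real (ns ! i)"
  let ?c = "\<lambda>i. zeta_weight ks ns * lagrange_weight (value_set ns) (?x i)"
  have pos: "0 < ?x i" if "i < length ks" for i using increasing_tuplesD(2)[OF ns that] by simp
  have "has_bochner_integral lborel
    (\<lambda>u. \<Sum>i<length ks. of_real (?c i * ?x i) * (indicator {0<..} u *\<^sub>R (complex_of_real u powr s * of_real (exp (- (?x i * u))))))
    (\<Sum>i<length ks. of_real (?c i * ?x i) * (Gamma (s + 1) / of_real (?x i) powr (s + 1)))"
    using pos s by (intro has_bochner_integral_sum has_bochner_integral_mult_right has_bochner_integral_Gamma) auto
  also have "(\<lambda>u. \<Sum>i<length ks. of_real (?c i * ?x i) * (indicator {0<..} u *\<^sub>R (complex_of_real u powr s * of_real (exp (- (?x i * u)))))) =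
    (\<lambda>u. (indicator {0<..} u * (zeta_weight ks ns * hypoexp_density (value_set ns) u)) *\<^sub>R (complex_of_real u powr s))"
  proof
    fix u :: real
    have "hypoexp_density (value_set ns) u = (\<Sum>i<length ks. lagrange_weight (value_set ns) (?x i) * ?x i * exp (- (?x i * u)))"
      unfolding hypoexp_density_def value_set_image(1)[OF ns] sum.reindex[OF value_set_image(2)[OF ns]] by (simp add: comp_def)
    then show "(\<Sum>i<length ks. of_real (?c i * ?x i) * (indicator {0<..} u *\<^sub>R (complex_of_real u powr s * of_real (exp (- (?x i * u)))))) =
      (indicator {0<..} u * (zeta_weight ks ns * hypoexp_density (value_set ns) u)) *\<^sub>R (complex_of_real u powr s)"
      by (auto simp: scaleR_conv_of_real sum_distrib_left sum_distrib_right mult_ac intro!: sum.cong split: split_indicator)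
  qed
  also have "(\<Sum>i<length ks. of_real (?c i * ?x i) * (Gamma (s + 1) / of_real (?x i) powr (s + 1))) =
      Gamma (s + 1) * (\<Sum>i<length ks. Ohno_term ks s i ns)"
    unfolding sum_distrib_left
  proof (intro sum.cong refl)
    fix i assume "i \<in> {..<length ks}"
    then have i: "i < length ks" by simp
    have "complex_of_real (?x i) powr (s + 1) = of_nat (ns ! i) powr s * of_real (?x i)"
      using pos[OF i] by (simp add: powr_add)
    then show "of_real (?c i * ?x i) * (Gamma (s + 1) / of_real (?x i) powr (s + 1)) = Gamma (s + 1) * Ohno_term ks s i ns"
      using pos[OF i] by (simp add: Ohno_term_eq_lagrange[OF ns i] mult_ac)
  qed
  finally show ?thesis .
qed

text \<open>The mixture of hypoexponential laws as a density on pairs of a tuple and a point of the half line;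
  the mixture itself is the image under the second projection. Keeping the tuple as a coordinate lets
  Fubini's theorem exchange the series with the integral.\<close>

definition mixture_density :: "nat list \<Rightarrow> nat list \<times> real \<Rightarrow> real" where
  "mixture_density ks x =
    indicator {0<..} (snd x) * (zeta_weight ks (fst x) * hypoexp_density (value_set (fst x)) (snd x))"

abbreviation tuple_line :: "nat list \<Rightarrow> (nat list \<times> real) measure" where
  "tuple_line ks \<equiv> count_space (increasing_tuples (length ks)) \<Otimes>\<^sub>M lborel"

lemma mixture_density_measurable [measurable]: "mixture_density ks \<in> borel_measurable (tuple_line ks)"
  by (rule measurable_pair_measure_countable1) (auto simp: mixture_density_def)

lemma mixture_density_nonneg:
  "0 < length ks \<Longrightarrow> ns \<in> increasing_tuples (length ks) \<Longrightarrow> 0 \<le> mixture_density ks (ns, u)"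
  by (auto simp: mixture_density_def hypoexp_density_nonneg value_set_props split: split_indicator)

lemma nn_integral_mixture_laplace:
  assumes ks: "0 < length ks" "\<And>j. j < length ks \<Longrightarrow> 1 \<le> ks ! j"
  shows "(\<integral>\<^sup>+x. ennreal (mixture_density ks x) * ennreal (exp (- (real N * snd x))) \<partial>tuple_line ks) =
    tuple_sum N ks (\<lambda>_. 1)"
proof -
  have "(\<integral>\<^sup>+x. ennreal (mixture_density ks x) * ennreal (exp (- (real N * snd x))) \<partial>tuple_line ks) =
    (\<integral>\<^sup>+ns. \<integral>\<^sup>+u. ennreal (mixture_density ks (ns, u)) * ennreal (exp (- (real N * u))) \<partial>lborel
      \<partial>count_space (increasing_tuples (length ks)))"
    by (subst lborel.nn_integral_fst[symmetric]) simp_all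
  also have "\<dots> = tuple_sum N ks (\<lambda>_. 1)"
    unfolding tuple_sum_def
  proof (rule nn_integral_cong)
    fix ns assume "ns \<in> space (count_space (increasing_tuples (length ks)))"
    then have ns: "ns \<in> increasing_tuples (length ks)" by simp
    note vs = value_set_props[OF ns ks(1)]
    have "(\<integral>\<^sup>+u. ennreal (mixture_density ks (ns, u)) * ennreal (exp (- (real N * u))) \<partial>lborel) =
      (\<integral>\<^sup>+u. ennreal (zeta_weight ks ns) *
        ennreal (indicator {0<..} u * hypoexp_density (value_set ns) u * exp (- (real N * u))) \<partial>lborel)"
      by (intro nn_integral_cong)
         (auto simp: mixture_density_def ennreal_mult' ennreal_mult'' mult.assoc hypoexp_density_nonneg vs split: split_indicator)
    also have "\<dots> = ennreal (zeta_weight ks ns) * ennreal (\<Prod>x\<in>value_set ns. x / (x + real N))"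
      by (subst nn_integral_cmult) (auto simp: nn_integral_hypoexp_laplace[OF vs])
    finally show "(\<integral>\<^sup>+u. ennreal (mixture_density ks (ns, u)) * ennreal (exp (- (real N * u))) \<partial>lborel) =
        ennreal (tuple_weight N ks ns) * 1"
      by (simp add: tuple_weight_eq[OF ks(2) ns] ennreal_mult')
  qed
  finally show ?thesis .
qed

lemma integrable_count_space_Ohno_term:
  assumes ks: "\<And>j. j < length ks \<Longrightarrow> 1 \<le> ks ! j" "2 \<le> ks ! (length ks - 1)"
    and "i < length ks" "- 1 < Re s"
  shows "integrable (count_space (increasing_tuples (length ks))) (Ohno_term ks s i)"
  using Ohno_term_abs_summable[OF assms] abs_summable_equivalent[of "Ohno_term ks s i"]
  unfolding Infinite_Set_Sum.abs_summable_on_def by simp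

lemma nn_integral_sum_norm_Ohno_term:
  assumes ks: "\<And>j. j < length ks \<Longrightarrow> 1 \<le> ks ! j" "2 \<le> ks ! (length ks - 1)" and s: "- 1 < Re s"
  shows "(\<integral>\<^sup>+ns. ennreal (\<Sum>i<length ks. norm (Ohno_term ks s i ns)) \<partial>count_space (increasing_tuples (length ks))) < \<infinity>"
proof -
  have "integrable (count_space (increasing_tuples (length ks))) (\<lambda>ns. \<Sum>i<length ks. norm (Ohno_term ks s i ns))"
    using integrable_count_space_Ohno_term[OF ks _ s] by (intro Bochner_Integration.integrable_sum integrable_norm) auto
  then show ?thesis
    by (simp add: integrable_iff_bounded sum_nonneg)
qed

text \<open>At \<open>z = 0\<close> the partial fraction identity says that the coefficients \<open>c\<^sub>i\<close> sum to one. Hence the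
  multiple zeta series is bounded by the absolute Ohno series at \<open>s = 0\<close>.\<close>

lemma tuple_sum_finite:
  assumes ks: "0 < length ks" "\<And>j. j < length ks \<Longrightarrow> 1 \<le> ks ! j" "2 \<le> ks ! (length ks - 1)"
  shows "tuple_sum 0 ks (\<lambda>_. 1) < \<infinity>"
proof -
  have "tuple_sum 0 ks (\<lambda>_. 1) \<le>
    (\<integral>\<^sup>+ns. ennreal (\<Sum>i<length ks. norm (Ohno_term ks 0 i ns)) \<partial>count_space (increasing_tuples (length ks)))"
    unfolding tuple_sum_def
  proof (rule nn_integral_mono)
    fix ns assume "ns \<in> space (count_space (increasing_tuples (length ks)))"
    then have ns: "ns \<in> increasing_tuples (length ks)" by simp
    note vs = value_set_props[OF ns ks(1)]
    have pos: "0 < ns ! i" if "i < length ks" for i using increasing_tuplesD(2)[OF ns that] .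
    have "(\<Sum>x\<in>value_set ns. lagrange_weight (value_set ns) x * (x / (x + 0))) = (\<Prod>x\<in>value_set ns. x / (x + 0))"
      by (rule partial_fractions) (use vs in force)+
    moreover have "x / (x + 0) = 1" if "x \<in> value_set ns" for x using vs(3)[OF that] by simp
    ultimately have one: "(\<Sum>x\<in>value_set ns. lagrange_weight (value_set ns) x) = 1"
      by simp
    have prod_one: "(\<Prod>x\<in>value_set ns. x / (x + real 0)) = 1"
      using vs(3) by (intro prod.neutral) force
    have "tuple_weight 0 ks ns = zeta_weight ks ns * (\<Sum>x\<in>value_set ns. lagrange_weight (value_set ns) x)"
      by (simp only: tuple_weight_eq[OF ks(2) ns] one prod_one)
    also have "\<dots> = (\<Sum>i<length ks. zeta_weight ks ns * lagrange_weight (value_set ns) (real (ns ! i)))"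
      unfolding value_set_image(1)[OF ns] sum.reindex[OF value_set_image(2)[OF ns]] by (simp add: sum_distrib_left)
    also have "\<dots> \<le> (\<Sum>i<length ks. norm (Ohno_term ks 0 i ns))"
    proof (rule sum_mono)
      fix i assume "i \<in> {..<length ks}"
      then have i: "i < length ks" by simp
      show "zeta_weight ks ns * lagrange_weight (value_set ns) (real (ns ! i)) \<le> norm (Ohno_term ks 0 i ns)"
        using pos[OF i] by (auto simp: Ohno_term_eq_lagrange[OF ns i] norm_mult intro!: mult_left_mono)
    qed
    finally show "ennreal (tuple_weight 0 ks ns) * 1 \<le> ennreal (\<Sum>i<length ks. norm (Ohno_term ks 0 i ns))"
      by (simp add: ennreal_leI)
  qed
  also have "\<dots> < \<infinity>" by (rule nn_integral_sum_norm_Ohno_term) (use ks in auto)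
  finally show ?thesis .
qed

text \<open>The absolute value of \<open>u\<^sup>s\<close> is \<open>u\<^sup>\<sigma>\<close> with \<open>\<sigma> = Re s\<close>. As the densities are nonnegative, the absolute
  moment for a single tuple is the moment of order \<open>\<sigma>\<close>, a combination of Ohno terms at \<open>\<sigma>\<close>, whose
  absolute sum over all tuples is finite.\<close>

lemma integrable_mixture_powr:
  assumes ks: "0 < length ks" "\<And>j. j < length ks \<Longrightarrow> 1 \<le> ks ! j" "2 \<le> ks ! (length ks - 1)"
    and s: "- 1 < Re s"
  shows "integrable (tuple_line ks) (\<lambda>x. mixture_density ks x *\<^sub>R complex_of_real (snd x) powr s)"
proof (rule integrableI_bounded)
  let ?\<sigma> = "complex_of_real (Re s)"
  let ?I = "increasing_tuples (length ks)"
  have \<sigma>: "- 1 < Re ?\<sigma>" using s by simp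
  have "(\<integral>\<^sup>+x. ennreal (norm (mixture_density ks x *\<^sub>R complex_of_real (snd x) powr s)) \<partial>tuple_line ks) =
    (\<integral>\<^sup>+ns. \<integral>\<^sup>+u. ennreal (norm (mixture_density ks (ns, u) *\<^sub>R complex_of_real u powr s)) \<partial>lborel \<partial>count_space ?I)"
    by (subst lborel.nn_integral_fst[symmetric]) simp_all
  also have "\<dots> \<le> (\<integral>\<^sup>+ns. ennreal (norm (Gamma (?\<sigma> + 1))) * ennreal (\<Sum>i<length ks. norm (Ohno_term ks ?\<sigma> i ns)) \<partial>count_space ?I)"
  proof (rule nn_integral_mono)
    fix ns assume "ns \<in> space (count_space ?I)"
    then have ns: "ns \<in> ?I" by simp
    define G where "G = (\<lambda>u. mixture_density ks (ns, u) *\<^sub>R complex_of_real u powr ?\<sigma>)"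
    have G: "has_bochner_integral lborel G (Gamma (?\<sigma> + 1) * (\<Sum>i<length ks. Ohno_term ks ?\<sigma> i ns))"
      using has_bochner_integral_hypoexp_powr[OF ns \<sigma>] by (simp add: G_def mixture_density_def)
    have int: "integrable lborel G" using G by (simp add: has_bochner_integral_iff)
    have nrm: "norm (mixture_density ks (ns, u) *\<^sub>R complex_of_real u powr s) = norm (G u)" for u
      by (cases "0 < u") (simp_all add: G_def mixture_density_def norm_powr_real_powr)
    \<comment> \<open>For the real exponent the integrand is its own absolute value.\<close>
    have G_norm: "complex_of_real (norm (G u)) = G u" for u
    proof (cases "0 < u")
      case True
      then have "complex_of_real u powr ?\<sigma> = of_real (u powr Re s)" by (simp add: powr_of_real)
      then have "G u = of_real (mixture_density ks (ns, u) * u powr Re s)"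
        by (simp add: G_def scaleR_conv_of_real)
      then show ?thesis
        using mixture_density_nonneg[OF ks(1) ns, of u] by (simp only: norm_of_real) simp
    qed (simp add: G_def mixture_density_def)
    have "complex_of_real (\<integral>u. norm (G u) \<partial>lborel) = (\<integral>u. G u \<partial>lborel)"
      unfolding integral_complex_of_real[symmetric] G_norm ..
    also have "\<dots> = Gamma (?\<sigma> + 1) * (\<Sum>i<length ks. Ohno_term ks ?\<sigma> i ns)"
      using G by (simp add: has_bochner_integral_iff)
    finally have "(\<integral>u. norm (G u) \<partial>lborel) = norm (Gamma (?\<sigma> + 1) * (\<Sum>i<length ks. Ohno_term ks ?\<sigma> i ns))"
      by (metis abs_of_nonneg integral_nonneg norm_ge_zero norm_of_real Bochner_Integration.integral_nonneg)
    also have "\<dots> \<le> norm (Gamma (?\<sigma> + 1)) * (\<Sum>i<length ks. norm (Ohno_term ks ?\<sigma> i ns))"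
      unfolding norm_mult by (intro mult_left_mono norm_sum) auto
    finally have le: "(\<integral>u. norm (G u) \<partial>lborel) \<le> \<dots>" .
    have "(\<integral>\<^sup>+u. ennreal (norm (mixture_density ks (ns, u) *\<^sub>R complex_of_real u powr s)) \<partial>lborel) =
        ennreal (\<integral>u. norm (G u) \<partial>lborel)"
      unfolding nrm using int by (intro nn_integral_eq_integral) auto
    also have "\<dots> \<le> ennreal (norm (Gamma (?\<sigma> + 1)) * (\<Sum>i<length ks. norm (Ohno_term ks ?\<sigma> i ns)))"
      using le by (rule ennreal_leI)
    finally show "(\<integral>\<^sup>+u. ennreal (norm (mixture_density ks (ns, u) *\<^sub>R complex_of_real u powr s)) \<partial>lborel) \<le>
      ennreal (norm (Gamma (?\<sigma> + 1))) * ennreal (\<Sum>i<length ks. norm (Ohno_term ks ?\<sigma> i ns))"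
      by (simp add: ennreal_mult sum_nonneg)
  qed
  also have "\<dots> < \<infinity>"
    using nn_integral_sum_norm_Ohno_term[OF ks(2,3) \<sigma>]
    by (subst nn_integral_cmult) (auto simp: ennreal_mult_less_top)
  finally show "(\<integral>\<^sup>+x. ennreal (norm (mixture_density ks x *\<^sub>R complex_of_real (snd x) powr s)) \<partial>tuple_line ks) < \<infinity>" .
qed measurable

lemma integral_mixture_powr:
  assumes ks: "0 < length ks" "\<And>j. j < length ks \<Longrightarrow> 1 \<le> ks ! j" "2 \<le> ks ! (length ks - 1)"
    and s: "- 1 < Re s"
  shows "(\<integral>x. mixture_density ks x *\<^sub>R complex_of_real (snd x) powr s \<partial>tuple_line ks) = Gamma (s + 1) * Ohno_function ks s"
proof -
  let ?I = "increasing_tuples (length ks)"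
  interpret pair_sigma_finite "count_space ?I" "lborel :: real measure"
    by (intro pair_sigma_finite.intro sigma_finite_measure_count_space_countable) (auto intro: lborel.sigma_finite_measure_axioms)
  have "(\<integral>x. mixture_density ks x *\<^sub>R complex_of_real (snd x) powr s \<partial>tuple_line ks) =
    (\<integral>ns. (\<integral>u. mixture_density ks (ns, u) *\<^sub>R complex_of_real u powr s \<partial>lborel) \<partial>count_space ?I)"
    using integral_fst'[OF integrable_mixture_powr[OF ks s]] by simp
  also have "\<dots> = (\<integral>ns. Gamma (s + 1) * (\<Sum>i<length ks. Ohno_term ks s i ns) \<partial>count_space ?I)"
    using has_bochner_integral_hypoexp_powr[OF _ s]
    by (intro Bochner_Integration.integral_cong refl) (simp add: has_bochner_integral_iff mixture_density_def)
  also have "\<dots> = Gamma (s + 1) * (\<Sum>i<length ks. \<integral>ns. Ohno_term ks s i ns \<partial>count_space ?I)"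
    using integrable_count_space_Ohno_term[OF ks(2,3) _ s]
    by (subst integral_mult_right_zero) (simp add: Bochner_Integration.integral_sum)
  also have "(\<Sum>i<length ks. \<integral>ns. Ohno_term ks s i ns \<partial>count_space ?I) = Ohno_function ks s"
    unfolding Ohno_function_def
  proof (intro sum.cong refl)
    fix i assume "i \<in> {..<length ks}"
    then have "Infinite_Set_Sum.abs_summable_on (Ohno_term ks s i) ?I"
      using integrable_count_space_Ohno_term[OF ks(2,3) _ s] by (simp add: Infinite_Set_Sum.abs_summable_on_def)
    then show "(\<integral>ns. Ohno_term ks s i ns \<partial>count_space ?I) = infsum (Ohno_term ks s i) ?I"
      using infsetsum_infsum by (simp add: infsetsum_def)
  qed
  finally show ?thesis .
qed

section \<open>The integral representation\<close>

definition log_ratio :: "nat \<Rightarrow> (nat \<Rightarrow> real) \<Rightarrow> real" where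
  "log_ratio d t = (let u = t(2 * d + 1 := 1) in ln ((\<Prod>l=1..d. u (2 * l)) / (\<Prod>l=1..d. u (2 * l - 1))))"

lemma log_ratio_measurable [measurable]: "log_ratio d \<in> borel_measurable (lebesgue_power (2 * d))"
  unfolding log_ratio_def[abs_def] Let_def
  by (intro borel_measurable_ln borel_measurable_divide borel_measurable_prod measurable_coord) auto

lemma log_ratio_props:
  assumes "chain d 1 t"
  shows "0 \<le> log_ratio d t"
    and "simplex_density d a b N 1 t = simplex_density d a b 0 1 t * exp (- (real N * log_ratio d t))"
proof -
  define u where "u = t(2 * d + 1 := 1)"
  define P where "P = (\<Prod>l=1..d. u (2 * l))"
  define Q where "Q = (\<Prod>l=1..d. u (2 * l - 1))"
  have pos: "0 < u (2 * l)" "0 < u (2 * l - 1)" "u (2 * l - 1) < u (2 * l)" if l: "l \<in> {1..d}" for l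
  proof -
    obtain k where k: "l = Suc k" using l by (cases l) auto
    show "0 < u (2 * l)" "0 < u (2 * l - 1)"
      using chain_pos[OF assms, of "2 * l - 1"] chain_pos[OF assms, of "2 * l - 2"] l unfolding u_def k by auto
    have "2 * l - 1 \<in> {1..2 * d}" using l by auto
    then have "u (2 * l - 1) < u (2 * l - 1 + 1)" using assms unfolding chain_def u_def by blast
    then show "u (2 * l - 1) < u (2 * l)" unfolding k by simp
  qed
  have Q: "0 < Q" unfolding Q_def using pos by (intro prod_pos) auto
  have "Q \<le> P" unfolding P_def Q_def using pos by (intro prod_mono) (auto intro: less_imp_le)
  have L: "log_ratio d t = ln (P / Q)" unfolding log_ratio_def Let_def u_def[symmetric] P_def Q_def ..
  show "0 \<le> log_ratio d t" unfolding L using Q \<open>Q \<le> P\<close> by (intro ln_ge_zero) simp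
  have "exp (- (real N * log_ratio d t)) = exp (- log_ratio d t) ^ N"
    by (simp add: exp_of_nat_mult[symmetric])
  also have "exp (- log_ratio d t) = Q / P"
    unfolding L using Q \<open>Q \<le> P\<close> by (simp add: exp_minus)
  also have "(Q / P) ^ N = (\<Prod>l=1..d. (u (2 * l - 1) / u (2 * l)) ^ N)"
    unfolding P_def Q_def prod_dividef[symmetric] by (rule prod_power_distrib)
  finally have "exp (- (real N * log_ratio d t)) = (\<Prod>l=1..d. (u (2 * l - 1) / u (2 * l)) ^ N)" .
  then show "simplex_density d a b N 1 t = simplex_density d a b 0 1 t * exp (- (real N * log_ratio d t))"
    unfolding simplex_density_def Let_def u_def[symmetric] by (simp add: prod.distrib[symmetric] block_factor_def)
qed

definition supported_density :: "nat \<Rightarrow> (nat \<Rightarrow> nat) \<Rightarrow> (nat \<Rightarrow> nat) \<Rightarrow> (nat \<Rightarrow> real) \<Rightarrow> real" where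
  "supported_density d a b t = (if chain d 1 t then simplex_density d a b 0 1 t else 0)"

lemma supported_density_measurable [measurable]:
  "supported_density d a b \<in> borel_measurable (lebesgue_power (2 * d))"
  unfolding supported_density_def[abs_def] by measurable

lemma supported_density_nonneg [simp]: "0 \<le> supported_density d a b t"
  by (simp add: supported_density_def simplex_density_nonneg)

text \<open>Both measures have the Laplace transform
  \<open>C \<Sum> \<Prod>\<^sub>j n\<^sub>j\<^bsup>-k\<^sub>j\<^esup> n\<^sub>j / (n\<^sub>j + N)\<close> at every natural number \<open>N\<close>.\<close>

lemma distr_log_ratio:
  assumes b: "\<And>l. l \<in> {1..d} \<Longrightarrow> b l \<ge> 1"
    and ks: "0 < length (block_index d a b)" "\<And>j. j < length (block_index d a b) \<Longrightarrow> 1 \<le> block_index d a b ! j"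
      "2 \<le> block_index d a b ! (length (block_index d a b) - 1)"
  defines "C \<equiv> \<Prod>l=1..d. fact (a l - 1) * fact (b l - 1)"
  shows "distr (density (lebesgue_power (2 * d)) (\<lambda>t. ennreal (supported_density d a b t))) borel (log_ratio d) =
    distr (density (tuple_line (block_index d a b)) (\<lambda>x. ennreal (C * mixture_density (block_index d a b) x))) borel snd"
    (is "?M1 = ?M2")
proof (rule measure_eqI_laplace)
  let ?ks = "block_index d a b"
  have C: "0 < C" unfolding C_def by (intro prod_pos) simp
  have M1: "(\<integral>\<^sup>+x. exp (- (real N * x)) \<partial>?M1) = ennreal C * tuple_sum N ?ks (\<lambda>_. 1)" for N
  proof -
    have "(\<integral>\<^sup>+x. exp (- (real N * x)) \<partial>?M1) =
      (\<integral>\<^sup>+t. ennreal (supported_density d a b t) * ennreal (exp (- (real N * log_ratio d t))) \<partial>lebesgue_power (2 * d))"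
      by (simp add: nn_integral_distr nn_integral_density)
    also have "\<dots> = (\<integral>\<^sup>+t. ennreal (simplex_density d a b N 1 t) * (if chain d 1 t then 1 else 0) \<partial>lebesgue_power (2 * d))"
      by (intro nn_integral_cong)
         (auto simp: supported_density_def log_ratio_props(2)[where N=N] ennreal_mult simplex_density_nonneg)
    also have "\<dots> = ennreal C * tuple_sum N ?ks (\<lambda>_. 1)"
      using nn_integral_simplex_density[of 1 d b a N] b by (simp add: C_def)
    finally show ?thesis .
  qed
  have M2: "(\<integral>\<^sup>+x. exp (- (real N * x)) \<partial>?M2) = ennreal C * tuple_sum N ?ks (\<lambda>_. 1)" for N
  proof -
    have "(\<integral>\<^sup>+x. exp (- (real N * x)) \<partial>?M2) =
      (\<integral>\<^sup>+x. ennreal C * (ennreal (mixture_density ?ks x) * ennreal (exp (- (real N * snd x)))) \<partial>tuple_line ?ks)"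
      using C by (simp add: nn_integral_distr nn_integral_density ennreal_mult' mult.assoc)
    also have "\<dots> = ennreal C * tuple_sum N ?ks (\<lambda>_. 1)"
      using nn_integral_mixture_laplace[OF ks(1,2)] by (subst nn_integral_cmult) auto
    finally show ?thesis .
  qed
  show "(\<integral>\<^sup>+x. exp (- (real N * x)) \<partial>?M1) = (\<integral>\<^sup>+x. exp (- (real N * x)) \<partial>?M2)" for N
    unfolding M1 M2 ..
  have "emeasure ?M1 (space ?M1) = (\<integral>\<^sup>+x. exp (- (real 0 * x)) \<partial>?M1)" by simp
  also have "\<dots> < \<infinity>"
    unfolding M1 using tuple_sum_finite[OF ks] by (simp add: ennreal_mult_less_top)
  finally show "emeasure ?M1 (space ?M1) < \<infinity>" .
  show "AE x in ?M1. 0 \<le> x"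
    by (subst AE_distr_iff) (auto simp: AE_density supported_density_def log_ratio_props(1))
  show "AE x in ?M2. 0 \<le> x"
  proof (subst AE_distr_iff)
    show "AE x in density (tuple_line ?ks) (\<lambda>x. ennreal (C * mixture_density ?ks x)). 0 \<le> snd x"
    proof (subst AE_density)
      show "AE x in tuple_line ?ks. 0 < ennreal (C * mixture_density ?ks x) \<longrightarrow> 0 \<le> snd x"
        by (rule AE_I2) (auto simp: mixture_density_def split: split_indicator_asm)
    qed measurable
  qed auto
qed simp_all

lemma open_simplex_iff_chain:
  assumes "d \<ge> 1" "t \<in> space (lebesgue_power (2 * d))"
  shows "t \<in> open_simplex (2 * d) \<longleftrightarrow> chain d 1 t"
proof -
  have e: "{1..2 * d} = insert (2 * d) {1..<2 * d}" using assms(1) by auto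
  show ?thesis
    using assms unfolding open_simplex_def chain_def e by auto
qed

lemma Ohno_integrand_eq:
  assumes "d \<ge> 1" "t \<in> space (lebesgue_power (2 * d))"
  shows "indicator (open_simplex (2 * d)) t *\<^sub>R Ohno_integrand d a b s t =
    supported_density d a b t *\<^sub>R complex_of_real (log_ratio d t) powr s"
proof -
  define u where "u = t(2 * d + 1 := 1)"
  define A where "A = (\<Prod>l=1..d. 1 / ((1 - u (2*l - 1)) * u (2*l)))"
  define B where "B = (\<Prod>l=1..d. ln ((1 - u (2*l - 1)) / (1 - u (2*l))) ^ (a l - 1) * ln (u (2*l + 1) / u (2*l)) ^ (b l - 1))"
  have "simplex_density d a b 0 1 t = A * B"
    unfolding simplex_density_def Let_def block_factor_def power_0 mult_1_right A_def B_def u_def prod.distrib ..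
  moreover have "Ohno_integrand d a b s t = of_real A * of_real B * complex_of_real (log_ratio d t) powr s"
    unfolding Ohno_integrand_def log_ratio_def Let_def A_def B_def u_def ..
  ultimately show ?thesis
    using open_simplex_iff_chain[OF assms]
    by (simp add: supported_density_def scaleR_conv_of_real indicator_def)
qed

lemma block_index_admissible:
  assumes "d \<ge> 1" "\<And>l. l \<in> {1..d} \<Longrightarrow> b l \<ge> 1"
  shows "0 < length (block_index d a b)" "\<And>j. j < length (block_index d a b) \<Longrightarrow> 1 \<le> block_index d a b ! j"
      "2 \<le> block_index d a b ! (length (block_index d a b) - 1)"
proof -
  obtain e where e: "d = Suc e" using assms(1) by (cases d) auto
  have bi: "block_index d a b = (block_index e a b @ replicate (a d - 1) 1) @ [(b d - 1) + 2]"
    using block_index_Suc[of b e a] assms(2)[of "Suc e"] unfolding e by simp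
  have ne: "block_index d a b \<noteq> []" unfolding bi by simp
  then show "0 < length (block_index d a b)" by simp
  have "2 \<le> last (block_index d a b)" unfolding bi by simp
  then show "2 \<le> block_index d a b ! (length (block_index d a b) - 1)" using ne by (simp add: last_conv_nth)
  have "\<forall>k\<in>set (block_index d a b). 1 \<le> k" by (auto simp: block_index_def)
  then show "\<And>j. j < length (block_index d a b) \<Longrightarrow> 1 \<le> block_index d a b ! j" by simp
qed

theorem theorem1p5:
  fixes d :: nat and a b :: "nat \<Rightarrow> nat" and s :: complex
  assumes "d \<ge> 1"
    and "\<And>l. l \<in> {1..d} \<Longrightarrow> a l \<ge> 1"
    and "\<And>l. l \<in> {1..d} \<Longrightarrow> b l \<ge> 1"
    and "Re s > -1"
  shows "(\<forall>i<length (block_index d a b).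
            (\<lambda>ns. norm (Ohno_term (block_index d a b) s i ns))
              summable_on increasing_tuples (length (block_index d a b)))
       \<and> set_integrable (lebesgue_power (2 * d)) (open_simplex (2 * d)) (Ohno_integrand d a b s)
       \<and> Ohno_function (block_index d a b) s =
           1 / ((\<Prod>l=1..d. fact (a l - 1) * fact (b l - 1)) * Gamma (s + 1)) *
           (LINT t:open_simplex (2 * d)|lebesgue_power (2 * d). Ohno_integrand d a b s t)"
proof -
  let ?ks = "block_index d a b"
  have ks: "0 < length ?ks" "\<And>j. j < length ?ks \<Longrightarrow> 1 \<le> ?ks ! j" "2 \<le> ?ks ! (length ?ks - 1)"
    using block_index_admissible[where d=d and a=a and b=b] assms(1,3) by blast+
  define C :: real where "C = (\<Prod>l=1..d. fact (a l - 1) * fact (b l - 1))"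
  have C: "0 < C" unfolding C_def by (intro prod_pos) simp
  define \<phi> where "\<phi> = (\<lambda>u. complex_of_real u powr s)"
  have [measurable]: "\<phi> \<in> borel_measurable borel" unfolding \<phi>_def by measurable
  define P where "P = density (lebesgue_power (2 * d)) (\<lambda>t. ennreal (supported_density d a b t))"
  define R where "R = density (tuple_line ?ks) (\<lambda>x. ennreal (C * mixture_density ?ks x))"
  have law: "distr P borel (log_ratio d) = distr R borel snd"
    unfolding P_def R_def C_def by (rule distr_log_ratio) (use assms(3) ks in auto)
  have [measurable]: "log_ratio d \<in> borel_measurable P" "snd \<in> borel_measurable R"
    unfolding P_def R_def by simp_all
  have nonneg: "AE x in tuple_line ?ks. 0 \<le> C * mixture_density ?ks x"
    using C mixture_density_nonneg[OF ks(1)] by (intro AE_I2) (auto simp: space_pair_measure)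
  have "integrable R (\<lambda>x. \<phi> (snd x))"
    unfolding R_def using nonneg integrable_mixture_powr[OF ks assms(4)]
    by (subst integrable_density) (auto simp: \<phi>_def scaleR_scaleR[symmetric] simp del: scaleR_scaleR)
  then have "integrable (distr P borel (log_ratio d)) \<phi>"
    unfolding law by (subst integrable_distr_eq) auto
  then have "integrable P (\<lambda>t. \<phi> (log_ratio d t))"
    by (subst (asm) integrable_distr_eq) auto
  then have int: "integrable (lebesgue_power (2 * d)) (\<lambda>t. supported_density d a b t *\<^sub>R \<phi> (log_ratio d t))"
    unfolding P_def by (subst (asm) integrable_density) auto
  have "(\<integral>t. supported_density d a b t *\<^sub>R \<phi> (log_ratio d t) \<partial>lebesgue_power (2 * d)) = (\<integral>t. \<phi> (log_ratio d t) \<partial>P)"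
    unfolding P_def by (subst integral_density) auto
  also have "\<dots> = (\<integral>u. \<phi> u \<partial>distr P borel (log_ratio d))"
    by (subst integral_distr) auto
  also have "\<dots> = (\<integral>x. \<phi> (snd x) \<partial>R)"
    unfolding law by (subst integral_distr) auto
  also have "\<dots> = (\<integral>x. C *\<^sub>R (mixture_density ?ks x *\<^sub>R \<phi> (snd x)) \<partial>tuple_line ?ks)"
    unfolding R_def using nonneg by (subst integral_density) auto
  also have "\<dots> = C *\<^sub>R (Gamma (s + 1) * Ohno_function ?ks s)"
    using integral_mixture_powr[OF ks assms(4)] by (simp add: \<phi>_def del: scaleR_scaleR)
  finally have main: "(LINT t:open_simplex (2 * d)|lebesgue_power (2 * d). Ohno_integrand d a b s t) =
      of_real C * Gamma (s + 1) * Ohno_function ?ks s"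
    unfolding set_lebesgue_integral_def
    using Ohno_integrand_eq[OF assms(1), of _ a b s]
    by (simp add: \<phi>_def scaleR_conv_of_real mult.assoc cong: Bochner_Integration.integral_cong)
  have "Gamma (s + 1) \<noteq> 0"
    using assms(4) by (intro Gamma_nonzero) (auto simp: nonpos_Ints_def complex_eq_iff)
  moreover have "of_real C = (\<Prod>l=1..d. fact (a l - 1) * fact (b l - 1) :: complex)"
    by (simp add: C_def)
  ultimately have "Ohno_function ?ks s = 1 / ((\<Prod>l=1..d. fact (a l - 1) * fact (b l - 1)) * Gamma (s + 1)) *
           (LINT t:open_simplex (2 * d)|lebesgue_power (2 * d). Ohno_integrand d a b s t)"
    unfolding main using C by (simp add: prod_zero_iff del: of_real_prod)
  moreover have "set_integrable (lebesgue_power (2 * d)) (open_simplex (2 * d)) (Ohno_integrand d a b s)"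
    unfolding set_integrable_def
    using int Ohno_integrand_eq[OF assms(1), of _ a b s]
    by (simp add: \<phi>_def cong: Bochner_Integration.integrable_cong)
  ultimately show ?thesis
    using Ohno_term_abs_summable[OF ks(2,3) _ assms(4)] by simp
qed

end
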